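(* Let $\mathbb{F}$ be an algebraically closed field with $\mathrm{Char}(\mathbb{F})\neq 2$ and let $d\ge 3$. Let $A,A^*$ be a Leonard pair over $\mathbb{F}$ with diameter $d$ that has dual $q$-Krawtchouk type. Let $(\{\theta_i\}_{i=0}^d;\{\theta^*_i\}_{i=0}^d;\{\varphi_i\}_{i=1}^d;\{\phi_i\}_{i=1}^d)$ be a parameter array of $A,A^*$ with corresponding primary $q$-data $(\delta,\mu,h,\delta^*,\mu^*,h^*,\tau)$. Choose scalars $\mu',h'\in\mathbb{F}$ with $\mu'+h'=0$ and $\mu'h'=\mu h$, and define $\{\theta'_i\}_{i=0}^d,\{\varphi'_i\}_{i=1}^d,\{\phi'_i\}_{i=1}^d$ by $\theta'_i=\mu'q^{2i-d}+h'q^{d-2i}$ and: if $\mu^*=0$, $$\varphi'_i=\mu'h^*q^{d-2i+1}(q^i-q^{-i})(q^{d-i+1}-q^{i-d-1}),\qquad \phi'_i=h'h^*q^{d-2i+1}(q^i-q^{-i})(q^{d-i+1}-q^{i-d-1});$$ if $h^*=0$, $$\varphi'_i=h'\mu^*q^{2i-d-1}(q^i-q^{-i})(q^{d-i+1}-q^{i-d-1}),\qquad \phi'_i=\mu'\mu^*q^{2i-d-1}(q^i-q^{-i})(q^{d-i+1}-q^{i-d-1}).$$ Then $A,A^*$ is near-bipartite if and only if $A,A^*$ is reinforced. In this case, the bipartite contraction of $A,A^*$ has reinforced dual $q$-Krawtchouk type with parameter array $(\{\theta'_i\}_{i=0}^d;\{\theta^*_i\}_{i=0}^d;\{\varphi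'_i\}_{i=1}^d;\{\phi'_i\}_{i=1}^d)$.
   Context: A tridiagonal matrix is irreducible if all its subdiagonal and superdiagonal entries are nonzero. Let $V$ be a vector space over $\mathbb{F}$ of dimension $d+1$. A Leonard pair on $V$ (with diameter $d$, over $\mathbb{F}$) is an ordered pair $A,A^*$ in $\mathrm{End}(V)$ such that (a) some basis of $V$ makes the matrix of $A$ irreducible tridiagonal and that of $A^*$ diagonal; (b) some basis of $V$ makes the matrix of $A^*$ irreducible tridiagonal and that of $A$ diagonal. ($A^*$ is just a name, not an adjoint.) Each of $A,A^*$ then has $d+1$ distinct eigenvalues. Flat part: let $E^*_0,\dots,E^*_d$ be the primitive idempotents of $A^*$ (projections onto its eigenspaces along the sum of the other eigenspaces). The flat part of $A$ is $F=\sum_{i=0}^d E^*_i A E^*_i$. $A,A^*$ is near-bipartite if $A-F,A^*$ is a Leonard pair on $V$; in that case $A-F,A^*$ is called the bipartite contraction of $A,A^*$. Parameter array: an ordering $\{\theta_i\}_{i=0}^d$ of the eigenvalues of $A$ is standard if in some basis $A$ is $\mathrm{diag}(\theta_0,\dots,\theta_d)$ and $A^*$ is irreducible tridiagonal; a standard ordering $\{\theta^*_i\}_{i=0}^d$ of the eigenvalues of $A^*$ is defined with the roles of $A$ and $A^*$ exchanged. Given standard orderings, there are unique scalars $\{\varphi_i\}_{i=1}^d$ such that in some basis $A$ is lower bidiagonal with diagonal $\theta_0,\dots,\theta_d$ and all subdiagonal entries $1$, while $A^*$ is upper bidiagonal with diagonal $\theta^*_0,\dots,\theta^*_d$ and superdiagonal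 $\varphi_1,\dots,\varphi_d$; and unique scalars $\{\phi_i\}_{i=1}^d$ such that in some basis $A$ is lower bidiagonal with diagonal $\theta_d,\theta_{d-1},\dots,\theta_0$ and all subdiagonal entries $1$, while $A^*$ is upper bidiagonal with diagonal $\theta^*_0,\dots,\theta^*_d$ and superdiagonal $\phi_1,\dots,\phi_d$. The sequence $(\{\theta_i\};\{\theta^*_i\};\{\varphi_i\};\{\phi_i\})$ is a parameter array of $A,A^*$. Type I: for $d\ge 3$ it is known that $\frac{\theta_{i-2}-\theta_{i+1}}{\theta_{i-1}-\theta_i}$ and $\frac{\theta^*_{i-2}-\theta^*_{i+1}}{\theta^*_{i-1}-\theta^*_i}$ are equal and independent of $i$ for $2\le i\le d-1$; their common value is written $\beta+1$, and $\beta$ is the fundamental constant. $A,A^*$ has type I if $\beta\neq\pm2$; then fix nonzero $q\in\mathbb{F}$ with $\beta=q^2+q^{-2}$ (so $q^4\ne1$). It is known that a parameter array of type I has the form $\theta_i=\delta+\mu q^{2i-d}+hq^{d-2i}$, $\theta^*_i=\delta^*+\mu^*q^{2i-d}+h^*q^{d-2i}$ $(0\le i\le d)$, $\varphi_i=(q^i-q^{-i})(q^{d-i+1}-q^{i-d-1})(\tau-\mu\mu^*q^{2i-d-1}-hh^*q^{d-2i+1})$, $\phi_i=(q^i-q^{-i})(q^{d-i+1}-q^{i-d-1})(\tau-h\mu^*q^{2i-d-1}-\mu h^*q^{d-2i+1})$ $(1\le i\le d)$ for a unique sequence $(\delta,\mu,h,\delta^*,\mu^*,h^*,\tau)$ of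 scalars in $\mathbb{F}$, called the corresponding primary $q$-data. $A,A^*$ has dual $q$-Krawtchouk type if it has type I, $(\theta^*_{i-1}-\theta^*_i)/(\theta^*_i-\theta^*_{i+1})$ is independent of $i$ for $1\le i\le d-1$, and $\varphi_i/\phi_i$ is independent of $i$ for $1\le i\le d$. In that case exactly one of $\mu^*,h^*$ is zero, and $\tau=0$. A Leonard pair of dual $q$-Krawtchouk type is reinforced if $q^{2i}\neq-1$ for $1\le i\le d-1$. *)

theory Defs
  imports "HOL-Computational_Algebra.Computational_Algebra"
begin

text \<open>
  The vector space \<open>V\<close> is the whole of the type \<open>'b\<close>, with scalar multiplication \<open>scale\<close> over
  the field \<open>'a\<close>; the definitions are meant for \<open>vector_space scale\<close>.
  A matrix is a function \<open>nat \<Rightarrow> nat \<Rightarrow> 'a\<close> of which only the entries \<open>M i j\<close> with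
  \<open>i, j \<le> d\<close> matter. Scalar sequences are functions on \<open>nat\<close>, relevant on \<open>{..d}\<close>
  (eigenvalues) or \<open>{1..d}\<close> (split sequences).
\<close>

definition diagonal :: "nat \<Rightarrow> (nat \<Rightarrow> nat \<Rightarrow> 'a::field) \<Rightarrow> bool" where
  "diagonal d M \<longleftrightarrow> (\<forall>i\<le>d. \<forall>j\<le>d. i \<noteq> j \<longrightarrow> M i j = 0)"

definition irreducible_tridiagonal :: "nat \<Rightarrow> (nat \<Rightarrow> nat \<Rightarrow> 'a::field) \<Rightarrow> bool" where
  "irreducible_tridiagonal d M \<longleftrightarrow>
     (\<forall>i\<le>d. \<forall>j\<le>d. i + 1 < j \<or> j + 1 < i \<longrightarrow> M i j = 0) \<and>
     (\<forall>i<d. M (i + 1) i \<noteq> 0 \<and> M i (i + 1) \<noteq> 0)"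

definition is_diag :: "nat \<Rightarrow> (nat \<Rightarrow> 'a::field) \<Rightarrow> (nat \<Rightarrow> nat \<Rightarrow> 'a) \<Rightarrow> bool" where
  "is_diag d t M \<longleftrightarrow> (\<forall>i\<le>d. \<forall>j\<le>d. M i j = (if i = j then t i else 0))"

definition is_lower_bidiagonal :: "nat \<Rightarrow> (nat \<Rightarrow> 'a::field) \<Rightarrow> (nat \<Rightarrow> nat \<Rightarrow> 'a) \<Rightarrow> bool" where
  "is_lower_bidiagonal d t M \<longleftrightarrow>
     (\<forall>i\<le>d. \<forall>j\<le>d. M i j = (if i = j then t i else if i = j + 1 then 1 else 0))"

text \<open>The entry in row \<open>i - 1\<close> and column \<open>i\<close> is \<open>s i\<close>, for \<open>1 \<le> i \<le> d\<close>.\<close>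

definition is_upper_bidiagonal ::
    "nat \<Rightarrow> (nat \<Rightarrow> 'a::field) \<Rightarrow> (nat \<Rightarrow> 'a) \<Rightarrow> (nat \<Rightarrow> nat \<Rightarrow> 'a) \<Rightarrow> bool" where
  "is_upper_bidiagonal d t s M \<longleftrightarrow>
     (\<forall>i\<le>d. \<forall>j\<le>d. M i j = (if i = j then t i else if j = i + 1 then s j else 0))"

definition ordered_basis ::
    "('a::field \<Rightarrow> 'b::ab_group_add \<Rightarrow> 'b) \<Rightarrow> nat \<Rightarrow> (nat \<Rightarrow> 'b) \<Rightarrow> bool" where
  "ordered_basis scale d v \<longleftrightarrow> inj_on v {..d} \<and> \<not> module.dependent scale (v ` {..d}) \<and> module.span scale (v ` {..d}) = UNIV"

text \<open>Column convention: \<open>T (v j) = (\<Sum>i\<le>d. scale (matrix_wrt scale d v T i j) (v i))\<close>.\<close>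

definition matrix_wrt ::
    "('a::field \<Rightarrow> 'b::ab_group_add \<Rightarrow> 'b) \<Rightarrow> nat \<Rightarrow> (nat \<Rightarrow> 'b) \<Rightarrow> ('b \<Rightarrow> 'b) \<Rightarrow> nat \<Rightarrow> nat \<Rightarrow> 'a" where
  "matrix_wrt scale d v T i j = module.representation scale (v ` {..d}) (T (v j)) (v i)"

definition leonard_pair ::
    "('a::field \<Rightarrow> 'b::ab_group_add \<Rightarrow> 'b) \<Rightarrow> nat \<Rightarrow> ('b \<Rightarrow> 'b) \<Rightarrow> ('b \<Rightarrow> 'b) \<Rightarrow> bool" where
  "leonard_pair scale d A As \<longleftrightarrow>
     vector_space.dim scale (UNIV :: 'b set) = d + 1 \<and>
     Vector_Spaces.linear scale scale A \<and> Vector_Spaces.linear scale scale As \<and>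
     (\<exists>v. ordered_basis scale d v \<and>
        irreducible_tridiagonal d (matrix_wrt scale d v A) \<and> diagonal d (matrix_wrt scale d v As)) \<and>
     (\<exists>v. ordered_basis scale d v \<and>
        irreducible_tridiagonal d (matrix_wrt scale d v As) \<and> diagonal d (matrix_wrt scale d v A))"

definition eigenspace ::
    "('a::field \<Rightarrow> 'b::ab_group_add \<Rightarrow> 'b) \<Rightarrow> ('b \<Rightarrow> 'b) \<Rightarrow> 'a \<Rightarrow> 'b set" where
  "eigenspace scale T t = {x. T x = scale t x}"

definition eigenvalues ::
    "('a::field \<Rightarrow> 'b::ab_group_add \<Rightarrow> 'b) \<Rightarrow> ('b \<Rightarrow> 'b) \<Rightarrow> 'a set" where
  "eigenvalues scale T = {t. eigenspace scale T t \<noteq> {0}}"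

text \<open>Meaningful only for diagonalizable \<open>T\<close> and \<open>t \<in> eigenvalues scale T\<close>.\<close>

definition primitive_idempotent ::
    "('a::field \<Rightarrow> 'b::ab_group_add \<Rightarrow> 'b) \<Rightarrow> ('b \<Rightarrow> 'b) \<Rightarrow> 'a \<Rightarrow> 'b \<Rightarrow> 'b" where
  "primitive_idempotent scale T t = (THE E.
     Vector_Spaces.linear scale scale E \<and> E \<circ> E = E \<and>
     range E = eigenspace scale T t \<and>
     {x. E x = 0} = module.span scale (\<Union>s \<in> eigenvalues scale T - {t}. eigenspace scale T s))"

definition flat_part ::
    "('a::field \<Rightarrow> 'b::ab_group_add \<Rightarrow> 'b) \<Rightarrow> ('b \<Rightarrow> 'b) \<Rightarrow> ('b \<Rightarrow> 'b) \<Rightarrow> 'b \<Rightarrow> 'b" where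
  "flat_part scale A As x =
     (\<Sum>t \<in> eigenvalues scale As.
        primitive_idempotent scale As t (A (primitive_idempotent scale As t x)))"

text \<open>The first member of the bipartite contraction; the second one is \<open>As\<close> itself.\<close>

definition contraction ::
    "('a::field \<Rightarrow> 'b::ab_group_add \<Rightarrow> 'b) \<Rightarrow> ('b \<Rightarrow> 'b) \<Rightarrow> ('b \<Rightarrow> 'b) \<Rightarrow> 'b \<Rightarrow> 'b" where
  "contraction scale A As x = A x - flat_part scale A As x"

definition near_bipartite ::
    "('a::field \<Rightarrow> 'b::ab_group_add \<Rightarrow> 'b) \<Rightarrow> nat \<Rightarrow> ('b \<Rightarrow> 'b) \<Rightarrow> ('b \<Rightarrow> 'b) \<Rightarrow> bool" where
  "near_bipartite scale d A As \<longleftrightarrow>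
     leonard_pair scale d A As \<and> leonard_pair scale d (contraction scale A As) As"

text \<open>A standard ordering of the eigenvalues of \<open>A\<close>; that of the eigenvalues of \<open>As\<close> is
  obtained by exchanging the arguments.\<close>

definition standard_ordering ::
    "('a::field \<Rightarrow> 'b::ab_group_add \<Rightarrow> 'b) \<Rightarrow> nat \<Rightarrow> ('b \<Rightarrow> 'b) \<Rightarrow> ('b \<Rightarrow> 'b) \<Rightarrow> (nat \<Rightarrow> 'a) \<Rightarrow> bool" where
  "standard_ordering scale d A As th \<longleftrightarrow>
     bij_betw th {..d} (eigenvalues scale A) \<and>
     (\<exists>v. ordered_basis scale d v \<and>
        is_diag d th (matrix_wrt scale d v A) \<and> irreducible_tridiagonal d (matrix_wrt scale d v As))"

text \<open>\<open>vphi\<close> and \<open>phi\<close> are the first and second split sequences, usually written with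
  the two variant forms of the Greek letter phi.\<close>

definition parameter_array ::
    "('a::field \<Rightarrow> 'b::ab_group_add \<Rightarrow> 'b) \<Rightarrow> nat \<Rightarrow> ('b \<Rightarrow> 'b) \<Rightarrow> ('b \<Rightarrow> 'b) \<Rightarrow>
     (nat \<Rightarrow> 'a) \<Rightarrow> (nat \<Rightarrow> 'a) \<Rightarrow> (nat \<Rightarrow> 'a) \<Rightarrow> (nat \<Rightarrow> 'a) \<Rightarrow> bool" where
  "parameter_array scale d A As th ths vphi phi \<longleftrightarrow>
     leonard_pair scale d A As \<and>
     standard_ordering scale d A As th \<and> standard_ordering scale d As A ths \<and>
     (\<exists>v. ordered_basis scale d v \<and>
        is_lower_bidiagonal d th (matrix_wrt scale d v A) \<and>
        is_upper_bidiagonal d ths vphi (matrix_wrt scale d v As)) \<and>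
     (\<exists>v. ordered_basis scale d v \<and>
        is_lower_bidiagonal d (\<lambda>i. th (d - i)) (matrix_wrt scale d v A) \<and>
        is_upper_bidiagonal d ths phi (matrix_wrt scale d v As))"

text \<open>The standard orderings are unique up to reversal, and reversal preserves the quotients
  below as a family; so the choice of standard orderings is immaterial, and \<open>\<beta>\<close> is
  determined by the pair when \<open>d \<ge> 3\<close>.\<close>

definition is_fundamental_constant ::
    "('a::field \<Rightarrow> 'b::ab_group_add \<Rightarrow> 'b) \<Rightarrow> nat \<Rightarrow> ('b \<Rightarrow> 'b) \<Rightarrow> ('b \<Rightarrow> 'b) \<Rightarrow> 'a \<Rightarrow> bool" where
  "is_fundamental_constant scale d A As \<beta> \<longleftrightarrow>
     3 \<le> d \<and> leonard_pair scale d A As \<and>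
     (\<exists>th ths. standard_ordering scale d A As th \<and> standard_ordering scale d As A ths \<and>
        (\<forall>i\<in>{2..d - 1}.
           (th (i - 2) - th (i + 1)) / (th (i - 1) - th i) = \<beta> + 1 \<and>
           (ths (i - 2) - ths (i + 1)) / (ths (i - 1) - ths i) = \<beta> + 1))"

definition type_I ::
    "('a::field \<Rightarrow> 'b::ab_group_add \<Rightarrow> 'b) \<Rightarrow> nat \<Rightarrow> ('b \<Rightarrow> 'b) \<Rightarrow> ('b \<Rightarrow> 'b) \<Rightarrow> bool" where
  "type_I scale d A As \<longleftrightarrow> (\<exists>\<beta>. is_fundamental_constant scale d A As \<beta> \<and> \<beta> \<noteq> 2 \<and> \<beta> \<noteq> - 2)"

text \<open>The scalar \<open>q\<close> is a fixed choice of a nonzero solution of \<open>\<beta> = q\<^sup>2 + q\<^sup>-\<^sup>2\<close>. The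
  conditions on the parameter array do not depend on which parameter array of the pair is
  used.\<close>

definition dual_q_krawtchouk_type ::
    "('a::field \<Rightarrow> 'b::ab_group_add \<Rightarrow> 'b) \<Rightarrow> nat \<Rightarrow> 'a \<Rightarrow> ('b \<Rightarrow> 'b) \<Rightarrow> ('b \<Rightarrow> 'b) \<Rightarrow> bool" where
  "dual_q_krawtchouk_type scale d q A As \<longleftrightarrow>
     type_I scale d A As \<and>
     q \<noteq> 0 \<and> is_fundamental_constant scale d A As (q powi 2 + q powi (- 2)) \<and>
     (\<exists>th ths vphi phi. parameter_array scale d A As th ths vphi phi \<and>
        (\<exists>c. \<forall>i\<in>{1..d - 1}. (ths (i - 1) - ths i) / (ths i - ths (i + 1)) = c) \<and>
        (\<exists>c. \<forall>i\<in>{1..d}. vphi i / phi i = c))"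

definition reinforced_dual_q_krawtchouk_type ::
    "('a::field \<Rightarrow> 'b::ab_group_add \<Rightarrow> 'b) \<Rightarrow> nat \<Rightarrow> 'a \<Rightarrow> ('b \<Rightarrow> 'b) \<Rightarrow> ('b \<Rightarrow> 'b) \<Rightarrow> bool" where
  "reinforced_dual_q_krawtchouk_type scale d q A As \<longleftrightarrow>
     dual_q_krawtchouk_type scale d q A As \<and> (\<forall>i\<in>{1..d - 1}. q ^ (2 * i) \<noteq> - 1)"

text \<open>The common factor \<open>(q\<^sup>i - q\<^sup>-\<^sup>i) (q\<^sup>d\<^sup>-\<^sup>i\<^sup>+\<^sup>1 - q\<^sup>i\<^sup>-\<^sup>d\<^sup>-\<^sup>1)\<close> of the split sequences.\<close>

definition split_factor :: "nat \<Rightarrow> 'a::field \<Rightarrow> nat \<Rightarrow> 'a" where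
  "split_factor d q i =
     (q powi int i - q powi (- int i)) *
     (q powi (int d - int i + 1) - q powi (int i - int d - 1))"

definition primary_q_data ::
    "nat \<Rightarrow> 'a::field \<Rightarrow> (nat \<Rightarrow> 'a) \<Rightarrow> (nat \<Rightarrow> 'a) \<Rightarrow> (nat \<Rightarrow> 'a) \<Rightarrow> (nat \<Rightarrow> 'a) \<Rightarrow>
     'a \<Rightarrow> 'a \<Rightarrow> 'a \<Rightarrow> 'a \<Rightarrow> 'a \<Rightarrow> 'a \<Rightarrow> 'a \<Rightarrow> bool" where
  "primary_q_data d q th ths vphi phi \<delta> \<mu> h \<delta>s \<mu>s hs \<tau> \<longleftrightarrow>
     (\<forall>i\<le>d. th i = \<delta> + \<mu> * q powi (2 * int i - int d) + h * q powi (int d - 2 * int i)) \<and>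
     (\<forall>i\<le>d. ths i = \<delta>s + \<mu>s * q powi (2 * int i - int d) + hs * q powi (int d - 2 * int i)) \<and>
     (\<forall>i\<in>{1..d}. vphi i = split_factor d q i *
        (\<tau> - \<mu> * \<mu>s * q powi (2 * int i - int d - 1) - h * hs * q powi (int d - 2 * int i + 1))) \<and>
     (\<forall>i\<in>{1..d}. phi i = split_factor d q i *
        (\<tau> - h * \<mu>s * q powi (2 * int i - int d - 1) - \<mu> * hs * q powi (int d - 2 * int i + 1)))"

end

theory Submission
  imports Defs
begin

text \<open>
  Exchanging \<open>q\<close> with \<open>q\<^sup>-\<^sup>1\<close> we may assume that \<open>hs = 0\<close>; then \<open>\<tau> = 0\<close>. Written in the basis of
  eigenvectors of \<open>As\<close> that is unitriangular over the split basis, \<open>A\<close> becomes tridiagonal with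
  subdiagonal \<open>1\<close>, diagonal \<open>\<delta> + (\<mu> + h) q\<^sup>d\<^sup>-\<^sup>2\<^sup>j\<close> and a superdiagonal depending on \<open>\<mu>, h\<close> only
  through \<open>\<mu> h\<close>. Deleting the diagonal therefore amounts to replacing \<open>(\<delta>, \<mu>, h)\<close> by \<open>(0, \<mu>', h')\<close>
  with \<open>\<mu>' + h' = 0\<close> and \<open>\<mu>' h' = \<mu> h\<close>, and reading the change of basis backwards yields both
  split bases of the contraction, whether or not it is part of a Leonard pair. Since bidiagonal
  matrices with nonzero subdiagonal are nonderogatory, it is one exactly if the \<open>th' i\<close> are
  distinct, which is the reinforcement condition.
\<close>

section \<open>Ordered bases and coordinates\<close>

text \<open>Nothing is known beforehand about Leonard pairs containing the contraction, so its split
  bases must come from the tridiagonal form alone. That this form is symmetric in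
  \<open>\<mu>\<close> and \<open>h\<close> is no accident: it can be computed from either split
  basis of the original pair, and passing from one to the other exchanges the two scalars. A second
  obstacle is that the type is defined through some parameter array, whereas the given one may
  differ by reversal of an ordering. What carries over is intrinsic: the differences of the
  eigenvalues of \<open>As\<close> form a geometric progression, which forces
  \<open>\<mu>s = 0\<close> or \<open>hs = 0\<close>; and the first and last diagonal entries of
  \<open>A\<close> in an eigenbasis of \<open>As\<close> add up to \<open>th 0 + th d\<close>, which
  forces \<open>\<tau> = 0\<close>. The remaining genericity is extracted too: no power
  \<open>q ^ (2 * l)\<close> with \<open>1 \<le> l \<le> d\<close> is 1 because the eigenvalues are
  distinct, and \<open>\<mu> * h \<noteq> 0\<close> because both split sequences start with a
  nonzero term.\<close>

locale coordinate_space = vector_space scale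
  for scale :: "'a::field \<Rightarrow> 'b::ab_group_add \<Rightarrow> 'b" (infixr \<open>*s\<close> 75)
begin

abbreviation linear_op :: "('b \<Rightarrow> 'b) \<Rightarrow> bool" where
  "linear_op \<equiv> Vector_Spaces.linear scale scale"

definition comb :: "nat \<Rightarrow> (nat \<Rightarrow> 'b) \<Rightarrow> (nat \<Rightarrow> 'a) \<Rightarrow> 'b" where
  "comb d v f = (\<Sum>i\<le>d. f i *s v i)"

definition coord :: "nat \<Rightarrow> (nat \<Rightarrow> 'b) \<Rightarrow> 'b \<Rightarrow> nat \<Rightarrow> 'a" where
  "coord d v x i = representation (v ` {..d}) x (v i)"

lemma matrix_wrt_eq_coord: "matrix_wrt scale d v T i j = coord d v (T (v j)) i"
  by (simp add: matrix_wrt_def coord_def)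

lemma linear_op_iff:
  "linear_op T \<longleftrightarrow> (\<forall>x y. T (x + y) = T x + T y) \<and> (\<forall>c x. T (c *s x) = c *s T x)"
  by (simp add: Vector_Spaces.linear_iff vector_space_axioms)

lemma linear_op_add: "linear_op T \<Longrightarrow> T (x + y) = T x + T y"
  and linear_op_scale: "linear_op T \<Longrightarrow> T (c *s x) = c *s T x"
  by (simp_all add: linear_op_iff)

lemma linear_op_zero: "linear_op T \<Longrightarrow> T 0 = 0"
  using linear_op_scale[of T 0 0] by simp

lemma linear_op_sum: "linear_op T \<Longrightarrow> T (\<Sum>i\<in>I. g i) = (\<Sum>i\<in>I. T (g i))"
  by (induction I rule: infinite_finite_induct) (simp_all add: linear_op_zero linear_op_add)

lemma linear_op_comb: "linear_op T \<Longrightarrow> T (comb d v f) = (\<Sum>i\<le>d. f i *s T (v i))"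
  by (simp add: comb_def linear_op_sum linear_op_scale)

lemma comb_cong: "(\<And>i. i \<le> d \<Longrightarrow> f i = g i) \<Longrightarrow> comb d v f = comb d v g"
  by (simp add: comb_def)

lemma comb_add: "comb d v f + comb d v g = comb d v (\<lambda>i. f i + g i)"
  by (simp add: comb_def scale_left_distrib sum.distrib)

lemma comb_scale: "c *s comb d v f = comb d v (\<lambda>i. c * f i)"
  by (simp add: comb_def scale_sum_right)

lemma comb_zero: "comb d v (\<lambda>i. 0) = 0"
  by (simp add: comb_def)

lemma comb_delta: "k \<le> d \<Longrightarrow> comb d v (\<lambda>i. if i = k then c else 0) = c *s v k"
  unfolding comb_def by (simp add: if_distrib[of "\<lambda>x. x *s _"] cong: if_cong)

lemma ordered_basis_finite_dimensional:
  "ordered_basis scale d v \<Longrightarrow> finite_dimensional_vector_space scale (v ` {..d})"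
  by unfold_locales (simp_all add: ordered_basis_def)

lemma comb_coord:
  assumes "ordered_basis scale d v"
  shows "comb d v (coord d v x) = x"
proof -
  have "(\<Sum>b\<in>v ` {..d}. representation (v ` {..d}) x b *s b) = x"
    using assms by (intro sum_representation_eq) (auto simp: ordered_basis_def)
  then show ?thesis
    using assms by (simp add: comb_def coord_def ordered_basis_def sum.reindex)
qed

lemma coord_add:
  "ordered_basis scale d v \<Longrightarrow> coord d v (x + y) i = coord d v x i + coord d v y i"
  by (simp add: coord_def ordered_basis_def representation_add)

lemma coord_scale:
  "ordered_basis scale d v \<Longrightarrow> coord d v (c *s x) i = c * coord d v x i"
  by (simp add: coord_def ordered_basis_def representation_scale)

lemma coord_zero: "coord d v 0 i = 0"
  by (simp add: coord_def representation_zero)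

lemma coord_sum:
  "ordered_basis scale d v \<Longrightarrow> coord d v (\<Sum>k\<in>I. g k) i = (\<Sum>k\<in>I. coord d v (g k) i)"
  by (simp add: coord_def ordered_basis_def representation_sum)

lemma coord_basis:
  "\<lbrakk>ordered_basis scale d v; i \<le> d; k \<le> d\<rbrakk> \<Longrightarrow> coord d v (v k) i = (if i = k then 1 else 0)"
  by (auto simp: coord_def ordered_basis_def representation_basis inj_on_def)

lemma coord_comb:
  assumes "ordered_basis scale d v" "i \<le> d"
  shows "coord d v (comb d v f) i = f i"
proof -
  have "coord d v (comb d v f) i = (\<Sum>k\<le>d. f k * (if i = k then 1 else 0))"
    using assms by (simp add: comb_def coord_sum coord_scale coord_basis)
  also have "\<dots> = (\<Sum>k\<le>d. if i = k then f k else 0)"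
    by (intro sum.cong) auto
  finally show ?thesis
    using assms(2) by simp
qed

lemma comb_eqD: "\<lbrakk>comb d v f = comb d v g; ordered_basis scale d v; i \<le> d\<rbrakk> \<Longrightarrow> f i = g i"
  by (metis coord_comb)

lemma coord_eqI:
  "\<lbrakk>ordered_basis scale d v; \<And>i. i \<le> d \<Longrightarrow> coord d v x i = coord d v y i\<rbrakk> \<Longrightarrow> x = y"
  by (metis comb_coord comb_cong)

lemma ordered_basis_nonzero: "\<lbrakk>ordered_basis scale d v; j \<le> d\<rbrakk> \<Longrightarrow> v j \<noteq> 0"
  by (metis coord_basis coord_zero zero_neq_one)

text \<open>Since \<open>d + 1\<close> vectors that span a space of dimension \<open>d + 1\<close>
  are distinct and independent, spanning is all that has to be checked for a new family.\<close>

lemma ordered_basis_spanningI: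
  assumes v: "ordered_basis scale d v"
    and w: "\<And>j. j \<le> d \<Longrightarrow> v j \<in> span (w ` {..d})"
  shows "ordered_basis scale d w"
proof -
  interpret F: finite_dimensional_vector_space scale "v ` {..d}"
    using v by (rule ordered_basis_finite_dimensional)
  have "v ` {..d} \<subseteq> span (w ` {..d})"
    using w by auto
  then have "span (v ` {..d}) \<subseteq> span (w ` {..d})"
    by (metis span_mono span_span)
  then have sp: "span (w ` {..d}) = UNIV"
    using v by (auto simp: ordered_basis_def)
  have dim: "dim UNIV = d + 1"
    using v F.dim_UNIV by (simp add: ordered_basis_def card_image)
  have "card (w ` {..d}) \<le> d + 1"
    using card_image_le[of "{..d}" w] by simp
  moreover from this have ind: "independent (w ` {..d})"
    by (intro F.card_le_dim_spanning[of _ UNIV]) (auto simp: sp dim simp del: F.dim_UNIV)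
  moreover have "card (w ` {..d}) = d + 1"
    using ind sp dim by (metis dim_eq_card_independent dim_span)
  then have "inj_on w {..d}"
    by (intro eq_card_imp_inj_on) auto
  ultimately show ?thesis
    using sp by (simp add: ordered_basis_def)
qed

lemma linear_op_eqI:
  assumes "ordered_basis scale d v" "linear_op S" "linear_op T"
    and "\<And>j. j \<le> d \<Longrightarrow> S (v j) = T (v j)"
  shows "S = T"
proof
  fix x
  have "S (comb d v (coord d v x)) = T (comb d v (coord d v x))"
    using assms by (simp add: linear_op_comb)
  then show "S x = T x"
    using assms(1) by (simp add: comb_coord)
qed

lemma matrix_wrt_column:
  assumes "ordered_basis scale d v"
  shows "T (v j) = comb d v (\<lambda>i. matrix_wrt scale d v T i j)"
  using comb_coord[OF assms, of "T (v j)"] by (simp add: matrix_wrt_eq_coord cong: comb_cong)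

lemma matrix_wrt_eqI:
  "\<lbrakk>ordered_basis scale d v; T (v j) = comb d v f; i \<le> d\<rbrakk> \<Longrightarrow> matrix_wrt scale d v T i j = f i"
  by (simp add: matrix_wrt_eq_coord coord_comb)

lemma is_diag_iff:
  assumes v: "ordered_basis scale d v"
  shows "is_diag d t (matrix_wrt scale d v T) \<longleftrightarrow> (\<forall>j\<le>d. T (v j) = t j *s v j)" (is "?L = ?R")
proof
  assume L: ?L
  have "T (v j) = comb d v (\<lambda>i. if i = j then t j else 0)" if "j \<le> d" for j
    using L that unfolding is_diag_def by (subst matrix_wrt_column[OF v]) (auto intro: comb_cong)
  then show ?R by (simp add: comb_delta)
next
  assume ?R
  then have "T (v j) = comb d v (\<lambda>i. if i = j then t j else 0)" if "j \<le> d" for j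
    using that by (simp add: comb_delta)
  then show ?L
    unfolding is_diag_def using matrix_wrt_eqI[OF v] by auto
qed

lemma lower_bidiagonal_comb:
  assumes "linear_op T" and v: "ordered_basis scale d v"
    and L: "is_lower_bidiagonal d t (matrix_wrt scale d v T)"
  shows "T (comb d v f) = comb d v (\<lambda>i. t i * f i + (if i = 0 then 0 else f (i - 1)))"
proof (rule coord_eqI[OF v])
  fix i assume i: "i \<le> d"
  have "coord d v (T (comb d v f)) i = (\<Sum>j\<le>d. f j * matrix_wrt scale d v T i j)"
    using assms by (simp add: linear_op_comb coord_sum coord_scale matrix_wrt_eq_coord)
  also have "\<dots> = (\<Sum>j\<le>d. (if j = i then t i * f i else 0) +
      (if j = i - 1 then (if i = 0 then 0 else f (i - 1)) else 0))"
    using L i unfolding is_lower_bidiagonal_def by (intro sum.cong) auto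
  also have "\<dots> = t i * f i + (if i = 0 then 0 else f (i - 1))"
    using i by (auto simp: sum.distrib)
  finally show "coord d v (T (comb d v f)) i =
      coord d v (comb d v (\<lambda>i. t i * f i + (if i = 0 then 0 else f (i - 1)))) i"
    using v i by (simp add: coord_comb)
qed

lemma upper_bidiagonal_comb:
  assumes "linear_op T" and v: "ordered_basis scale d v"
    and U: "is_upper_bidiagonal d t s (matrix_wrt scale d v T)"
  shows "T (comb d v f) = comb d v (\<lambda>i. t i * f i + (if i = d then 0 else s (i + 1) * f (i + 1)))"
proof (rule coord_eqI[OF v])
  fix i assume i: "i \<le> d"
  have "coord d v (T (comb d v f)) i = (\<Sum>j\<le>d. f j * matrix_wrt scale d v T i j)"
    using assms by (simp add: linear_op_comb coord_sum coord_scale matrix_wrt_eq_coord)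
  also have "\<dots> = (\<Sum>j\<le>d. (if j = i then t i * f i else 0) +
      (if j = i + 1 then (if i = d then 0 else s (i + 1) * f (i + 1)) else 0))"
    using U i unfolding is_upper_bidiagonal_def by (intro sum.cong) auto
  also have "\<dots> = t i * f i + (if i = d then 0 else s (i + 1) * f (i + 1))"
    using i by (auto simp: sum.distrib)
  finally show "coord d v (T (comb d v f)) i =
      coord d v (comb d v (\<lambda>i. t i * f i + (if i = d then 0 else s (i + 1) * f (i + 1)))) i"
    using v i by (simp add: coord_comb)
qed

lemma is_lower_bidiagonalI:
  assumes v: "ordered_basis scale d v"
    and T: "\<And>j. j \<le> d \<Longrightarrow> T (v j) = t j *s v j + (if j < d then v (j + 1) else 0)"
  shows "is_lower_bidiagonal d t (matrix_wrt scale d v T)"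
  unfolding is_lower_bidiagonal_def matrix_wrt_eq_coord
  using assms by (auto simp: T coord_add coord_scale coord_basis coord_zero)

lemma is_upper_bidiagonalI:
  assumes v: "ordered_basis scale d v"
    and T: "\<And>j. j \<le> d \<Longrightarrow> T (v j) = t j *s v j + (if j = 0 then 0 else s j *s v (j - 1))"
  shows "is_upper_bidiagonal d t s (matrix_wrt scale d v T)"
  unfolding is_upper_bidiagonal_def matrix_wrt_eq_coord
  using assms by (auto simp: T coord_add coord_scale coord_basis coord_zero)

lemma exists_linear_op_on_basis:
  assumes v: "ordered_basis scale d v"
  obtains T where "linear_op T" "\<And>j. j \<le> d \<Longrightarrow> T (v j) = g j"
proof
  let ?T = "\<lambda>x. \<Sum>k\<le>d. coord d v x k *s g k"
  show "linear_op ?T"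
    using v by (simp add: linear_op_iff coord_add coord_scale scale_left_distrib sum.distrib
        scale_sum_right)
  show "?T (v j) = g j" if "j \<le> d" for j
  proof -
    have "?T (v j) = (\<Sum>k\<le>d. if k = j then g k else 0)"
      using v that by (intro sum.cong) (auto simp: coord_basis)
    then show ?thesis using that by simp
  qed
qed

section \<open>Triangular changes of basis\<close>

lemma comb_in_span: "comb d v f \<in> span (v ` {..d})"
  unfolding comb_def by (intro span_sum span_scale span_base) auto

text \<open>The rank \<open>r\<close> makes one statement serve both shapes: the identity for upper
  and \<open>d - i\<close> for lower unitriangular matrices. Solving column \<open>j\<close> for
  \<open>v j\<close> involves only vectors of smaller rank.\<close>

lemma ordered_basis_triangularI:
  fixes r :: "nat \<Rightarrow> nat"
  assumes v: "ordered_basis scale d v"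
    and diag: "\<And>j. j \<le> d \<Longrightarrow> c j j = 1"
    and tri: "\<And>i j. \<lbrakk>i \<le> d; j \<le> d; i \<noteq> j; c i j \<noteq> 0\<rbrakk> \<Longrightarrow> r i < r j"
  shows "ordered_basis scale d (\<lambda>j. comb d v (\<lambda>i. c i j))"
proof (rule ordered_basis_spanningI[OF v])
  let ?w = "\<lambda>j. comb d v (\<lambda>i. c i j)"
  fix j assume "j \<le> d"
  then show "v j \<in> span (?w ` {..d})"
  proof (induction "r j" arbitrary: j rule: less_induct)
    case less
    have "?w j = c j j *s v j + (\<Sum>i\<in>{..d} - {j}. c i j *s v i)"
      using less.prems by (simp add: comb_def sum.remove)
    then have "v j = ?w j - (\<Sum>i\<in>{..d} - {j}. c i j *s v i)"
      using less.prems diag by simp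
    moreover have "(\<Sum>i\<in>{..d} - {j}. c i j *s v i) \<in> span (?w ` {..d})"
    proof (rule span_sum)
      fix i assume i: "i \<in> {..d} - {j}"
      show "c i j *s v i \<in> span (?w ` {..d})"
      proof (cases "c i j = 0")
        case False
        then have "r i < r j"
          using i less.prems tri[of i j] by simp
        then show ?thesis
          using less.hyps[of i] i span_scale by simp
      qed (simp add: span_zero)
    qed
    moreover have "?w j \<in> span (?w ` {..d})"
      using less.prems by (intro span_base imageI) simp
    ultimately show ?case
      using span_diff by simp
  qed
qed

text \<open>An operator replaces the inverse of the matrix \<open>c\<close>: if \<open>S\<close>
  carries the combinations \<open>?F j\<close> of \<open>E\<close> back to \<open>E j\<close>, then
  applying \<open>S\<close> to the definition of \<open>?F j\<close> exhibits \<open>E j\<close> as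
  the same combination of the vectors \<open>S (E i)\<close>.\<close>

lemma exists_basis_with_unitriangular_change:
  assumes E: "ordered_basis scale d E"
    and diag: "\<And>j. j \<le> d \<Longrightarrow> c j j = 1" and upper: "\<And>i j. j < i \<Longrightarrow> c i j = 0"
  obtains v where "ordered_basis scale d v" "\<And>j. j \<le> d \<Longrightarrow> E j = comb d v (\<lambda>i. c i j)"
proof -
  let ?F = "\<lambda>j. comb d E (\<lambda>i. c i j)"
  have F: "ordered_basis scale d ?F"
  proof (rule ordered_basis_triangularI[OF E, where r = "\<lambda>i. i"])
    show "i < j" if "i \<noteq> j" "c i j \<noteq> 0" for i j
      using upper[of j i] that by (cases i j rule: linorder_cases) simp_all
  qed (rule diag)
  obtain S where S: "linear_op S" and SF: "\<And>j. j \<le> d \<Longrightarrow> S (?F j) = E j"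
    using exists_linear_op_on_basis[OF F] by blast
  let ?v = "\<lambda>j. S (E j)"
  have *: "E j = comb d ?v (\<lambda>i. c i j)" if "j \<le> d" for j
    using SF[OF that] S by (simp add: linear_op_comb) (simp add: comb_def)
  have "ordered_basis scale d ?v"
  proof (rule ordered_basis_spanningI[OF E])
    fix j assume "j \<le> d"
    have "comb d ?v (\<lambda>i. c i j) \<in> span (?v ` {..d})"
      by (rule comb_in_span)
    then show "E j \<in> span (?v ` {..d})"
      by (simp only: *[OF \<open>j \<le> d\<close>, symmetric])
  qed
  with * that show thesis by blast
qed

section \<open>Eigenbases\<close>

definition eigenbasis :: "nat \<Rightarrow> ('b \<Rightarrow> 'b) \<Rightarrow> (nat \<Rightarrow> 'b) \<Rightarrow> (nat \<Rightarrow> 'a) \<Rightarrow> bool" where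
  "eigenbasis d T E s \<longleftrightarrow> ordered_basis scale d E \<and> (\<forall>j\<le>d. T (E j) = s j *s E j)"

lemma eigenbasisD:
  assumes "eigenbasis d T E s"
  shows "ordered_basis scale d E" and "j \<le> d \<Longrightarrow> T (E j) = s j *s E j"
  using assms by (simp_all add: eigenbasis_def)

lemma eigenbasis_comb:
  assumes "linear_op T" and "eigenbasis d T E s"
  shows "T (comb d E f) = comb d E (\<lambda>i. s i * f i)"
  using assms by (simp add: linear_op_comb eigenbasis_def) (simp add: comb_def mult.commute)

lemma eigenvector_coord:
  assumes T: "linear_op T" and ev: "eigenbasis d T E s"
    and x: "T x = t *s x" and i: "i \<le> d" "coord d E x i \<noteq> 0"
  shows "t = s i"
proof -
  note E = eigenbasisD(1)[OF ev]
  have "T (comb d E (coord d E x)) = t *s comb d E (coord d E x)"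
    using E x by (simp add: comb_coord)
  then have "comb d E (\<lambda>i. s i * coord d E x i) = comb d E (\<lambda>i. t * coord d E x i)"
    by (simp only: eigenbasis_comb[OF T ev] comb_scale)
  from comb_eqD[OF this E i(1)] i(2) show ?thesis
    by simp
qed

lemma eigenvector_unique:
  assumes T: "linear_op T" and ev: "eigenbasis d T E s" and inj: "inj_on s {..d}"
    and x: "T x = s k *s x" and k: "k \<le> d"
  shows "x = coord d E x k *s E k"
proof -
  have "coord d E x i = (if i = k then coord d E x k else 0)" if "i \<le> d" for i
    using eigenvector_coord[OF T ev x that] inj_onD[OF inj, of k i] that k by auto
  then have "comb d E (coord d E x) = comb d E (\<lambda>i. if i = k then coord d E x k else 0)"
    by (rule comb_cong)
  then show ?thesis
    using eigenbasisD(1)[OF ev] k by (simp add: comb_coord comb_delta)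
qed

lemma eigenvalues_eigenbasis:
  assumes T: "linear_op T" and ev: "eigenbasis d T E s"
  shows "eigenvalues scale T = s ` {..d}"
proof
  note E = eigenbasisD(1)[OF ev]
  show "eigenvalues scale T \<subseteq> s ` {..d}"
  proof
    fix t assume "t \<in> eigenvalues scale T"
    then obtain x where x: "T x = t *s x" "x \<noteq> 0"
      using linear_op_zero[OF T] by (auto simp: eigenvalues_def eigenspace_def)
    then obtain i where "i \<le> d" "coord d E x i \<noteq> 0"
      using coord_eqI[OF E, of x 0] by (auto simp: coord_zero)
    then show "t \<in> s ` {..d}"
      using eigenvector_coord[OF T ev x(1)] by auto
  qed
  show "s ` {..d} \<subseteq> eigenvalues scale T"
    using eigenbasisD(2)[OF ev] ordered_basis_nonzero[OF E]
    by (auto simp: eigenvalues_def eigenspace_def)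
qed

section \<open>Operators with a lower bidiagonal matrix\<close>

lemma lower_bidiagonal_eigenvector:
  assumes T: "linear_op T" and v: "ordered_basis scale d v"
    and L: "is_lower_bidiagonal d t (matrix_wrt scale d v T)"
    and x: "T x = a *s x" and i: "i \<le> d"
  shows "t i * coord d v x i + (if i = 0 then 0 else coord d v x (i - 1)) = a * coord d v x i"
proof -
  have "T (comb d v (coord d v x)) = a *s comb d v (coord d v x)"
    using v x by (simp add: comb_coord)
  then show ?thesis
    unfolding lower_bidiagonal_comb[OF T v L] comb_scale by (rule comb_eqD[OF _ v i])
qed

text \<open>Row \<open>i + 1\<close> of the eigenvector equation expresses coordinate
  \<open>i\<close> through coordinate \<open>i + 1\<close>, because the subdiagonal entries are 1.
  So the last coordinate is an injective functional on every eigenspace.\<close>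

lemma lower_bidiagonal_nonderogatory:
  assumes T: "linear_op T" and v: "ordered_basis scale d v"
    and L: "is_lower_bidiagonal d t (matrix_wrt scale d v T)"
    and x: "T x = a *s x" and last: "coord d v x d = 0"
  shows "x = 0"
proof -
  have "coord d v x i = 0" if "i \<le> d" for i
    using that
  proof (induction rule: inc_induct)
    case (step n)
    with lower_bidiagonal_eigenvector[OF T v L x, of "Suc n"] show ?case
      by simp
  qed (rule last)
  then show ?thesis
    using coord_eqI[OF v, of x 0] by (simp add: coord_zero)
qed

text \<open>At the first nonzero coordinate of an eigenvector the subdiagonal contributes nothing,
  so the diagonal entry there is the eigenvalue.\<close>

lemma lower_bidiagonal_eigenvalue:
  assumes T: "linear_op T" and v: "ordered_basis scale d v"
    and L: "is_lower_bidiagonal d t (matrix_wrt scale d v T)"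
    and x: "T x = a *s x" "x \<noteq> 0"
  shows "a \<in> t ` {..d}"
proof -
  let ?P = "\<lambda>i. i \<le> d \<and> coord d v x i \<noteq> 0"
  obtain k where "?P k"
    using coord_eqI[OF v, of x 0] x(2) by (auto simp: coord_zero)
  then have P: "?P (LEAST i. ?P i)"
    by (rule LeastI)
  let ?i = "LEAST i. ?P i"
  have "coord d v x (?i - 1) = 0" if "?i \<noteq> 0"
    using not_less_Least[of "?i - 1" ?P] P that by auto
  then have "t ?i = a"
    using lower_bidiagonal_eigenvector[OF T v L x(1), of ?i] P by (auto split: if_splits)
  with P show ?thesis by auto
qed

text \<open>An eigenvector is determined by its last coordinate, so no eigenvalue can repeat.\<close>

lemma lower_bidiagonal_diagonalizable_inj:
  assumes T: "linear_op T" and v: "ordered_basis scale d v"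
    and L: "is_lower_bidiagonal d t (matrix_wrt scale d v T)"
    and ev: "eigenbasis d T w u"
  shows "inj_on t {..d}"
proof -
  note w = eigenbasisD(1)[OF ev]
  have "inj_on u {..d}"
  proof (rule inj_onI, rule ccontr)
    fix i j assume ij: "i \<in> {..d}" "j \<in> {..d}" "u i = u j" "i \<noteq> j"
    let ?a = "coord d v (w i) d" and ?b = "coord d v (w j) d"
    \<comment> \<open>Chosen so that the last coordinates cancel.\<close>
    let ?x = "?b *s w i + (- ?a) *s w j"
    have "T ?x = u i *s ?x"
      using ij eigenbasisD(2)[OF ev] T by (simp add: linear_op_add linear_op_scale
          scale_right_distrib mult.commute del: scale_minus_left)
    moreover have "coord d v ?x d = 0"
      using v by (simp add: coord_add coord_scale mult.commute del: scale_minus_left)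
    ultimately have "?x = 0"
      by (rule lower_bidiagonal_nonderogatory[OF T v L])
    then have "coord d w ?x j = 0"
      by (simp add: coord_zero)
    then have "?a = 0"
      using w ij by (simp add: coord_add coord_scale coord_basis del: scale_minus_left)
    then have "w i = 0"
      using lower_bidiagonal_nonderogatory[OF T v L eigenbasisD(2)[OF ev]] ij by simp
    then show False
      using ordered_basis_nonzero[OF w] ij by auto
  qed
  then have "card (u ` {..d}) = Suc d"
    by (simp add: card_image)
  \<comment> \<open>The \<open>d + 1\<close> distinct values of \<open>u\<close> all occur among
    \<open>t 0, ..., t d\<close>, which leaves no room for a repetition in \<open>t\<close>.\<close>
  moreover have "u ` {..d} \<subseteq> t ` {..d}"
    using lower_bidiagonal_eigenvalue[OF T v L eigenbasisD(2)[OF ev]] ordered_basis_nonzero[OF w] by auto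
  ultimately have "Suc d \<le> card (t ` {..d})"
    by (metis card_mono finite_atMost finite_imageI)
  then have "card (t ` {..d}) = card {..d}"
    using card_image_le[of "{..d}" t] by simp
  then show ?thesis
    by (simp add: eq_card_imp_inj_on)
qed

section \<open>Primitive idempotents and the flat part\<close>

lemma primitive_idempotent_eigenbasis:
  assumes T: "linear_op T" and ev: "eigenbasis d T E s" and inj: "inj_on s {..d}" and k: "k \<le> d"
  shows "primitive_idempotent scale T (s k) = (\<lambda>x. coord d E x k *s E k)"
proof -
  note E = eigenbasisD(1)[OF ev]
  let ?P = "\<lambda>x. coord d E x k *s E k"
  let ?K = "\<Union>s' \<in> eigenvalues scale T - {s k}. eigenspace scale T s'"
  have eigs: "eigenspace scale T (s k) = {x. x = coord d E x k *s E k}"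
  proof (intro set_eqI iffI)
    fix x assume "x \<in> {x. x = coord d E x k *s E k}"
    then have x: "x = coord d E x k *s E k" by simp
    have "T (coord d E x k *s E k) = s k *s coord d E x k *s E k"
      using eigenbasisD(2)[OF ev k] T by (simp add: linear_op_scale mult.commute)
    then show "x \<in> eigenspace scale T (s k)"
      unfolding eigenspace_def by (simp flip: x)
  qed (use eigenvector_unique[OF T ev inj _ k] in \<open>simp add: eigenspace_def\<close>)
  have Pidem: "?P (?P x) = ?P x" for x
    using E k by (simp add: coord_scale coord_basis)
  have lin: "linear_op ?P"
    using E by (simp add: linear_op_iff coord_add coord_scale scale_left_distrib)
  have rng: "range ?P = eigenspace scale T (s k)"
    unfolding eigs using Pidem by (auto simp: image_iff)
  have ker: "{x. ?P x = 0} = span ?K"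
  proof
    show "span ?K \<subseteq> {x. ?P x = 0}"
    proof (rule span_minimal)
      show "?K \<subseteq> {x. ?P x = 0}"
        using eigenvector_coord[OF T ev _ k] by (auto simp: eigenspace_def)
      show "subspace {x. ?P x = 0}"
        using E by (auto simp: subspace_def coord_add coord_scale coord_zero)
    qed
    show "{x. ?P x = 0} \<subseteq> span ?K"
    proof
      fix x assume "x \<in> {x. ?P x = 0}"
      then have x: "coord d E x k = 0"
        using ordered_basis_nonzero[OF E k] by simp
      have "comb d E (coord d E x) \<in> span ?K"
        unfolding comb_def
      proof (rule span_sum)
        fix i assume i: "i \<in> {..d}"
        show "coord d E x i *s E i \<in> span ?K"
        proof (cases "i = k")
          case False
          then have "s i \<in> eigenvalues scale T - {s k}"
            using i k inj by (auto simp: eigenvalues_eigenbasis[OF T ev] inj_on_def)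
          moreover have "E i \<in> eigenspace scale T (s i)"
            using eigenbasisD(2)[OF ev] i by (simp add: eigenspace_def)
          ultimately show ?thesis
            by (intro span_scale span_base) blast
        qed (simp add: x span_zero)
      qed
      then show "x \<in> span ?K"
        using E by (simp add: comb_coord)
    qed
  qed
  show ?thesis
    unfolding primitive_idempotent_def
  proof (rule the_equality, intro conjI)
    \<comment> \<open>A projection is determined by its range and kernel: \<open>x\<close> splits
      into \<open>?P x\<close> in the range and \<open>x - ?P x\<close> in the kernel.\<close>
    fix Q assume Q: "linear_op Q \<and> Q \<circ> Q = Q \<and> range Q = eigenspace scale T (s k) \<and>
      {x. Q x = 0} = span ?K"
    show "Q = ?P"
    proof
      fix x
      have "Q (x - ?P x) = Q x - Q (?P x)"
        using Q by (metis (no_types, lifting) add_diff_cancel_right' diff_add_cancel linear_op_add)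
      moreover have "x - ?P x \<in> {x. ?P x = 0}"
        using linear_op_add[OF lin, of "x - ?P x" "?P x"] Pidem by simp
      then have "Q (x - ?P x) = 0"
        unfolding ker using Q by blast
      moreover have "?P x \<in> range Q"
        using Q rng by blast
      then have "Q (?P x) = ?P x"
        using Q by (metis comp_apply imageE)
      ultimately show "Q x = ?P x"
        by simp
    qed
  qed (use lin rng ker Pidem in \<open>auto simp: fun_eq_iff\<close>)
qed

lemma flat_part_eigenbasis:
  assumes A: "linear_op A" and T: "linear_op T" and ev: "eigenbasis d T E s"
    and inj: "inj_on s {..d}"
  shows "flat_part scale A T x = comb d E (\<lambda>i. matrix_wrt scale d E A i i * coord d E x i)"
proof -
  have "flat_part scale A T x = (\<Sum>i\<le>d. primitive_idempotent scale T (s i)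
      (A (primitive_idempotent scale T (s i) x)))"
    unfolding flat_part_def eigenvalues_eigenbasis[OF T ev] using inj
    by (simp add: sum.reindex)
  also have "\<dots> = comb d E (\<lambda>i. matrix_wrt scale d E A i i * coord d E x i)"
    unfolding comb_def
    using A eigenbasisD(1)[OF ev] by (intro sum.cong refl)
      (simp add: primitive_idempotent_eigenbasis[OF T ev inj]
        linear_op_scale coord_scale matrix_wrt_eq_coord mult.commute)
  finally show ?thesis .
qed

lemma flat_part_eigenvector:
  assumes "linear_op A" "linear_op T" "eigenbasis d T E s" "inj_on s {..d}" and "k \<le> d"
  shows "flat_part scale A T (E k) = matrix_wrt scale d E A k k *s E k"
proof -
  have "flat_part scale A T (E k) =
      comb d E (\<lambda>i. if i = k then matrix_wrt scale d E A k k else 0)"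
    unfolding flat_part_eigenbasis[OF assms(1-4)] using eigenbasisD(1)[OF assms(3)] assms(5)
    by (intro comb_cong) (auto simp: coord_basis)
  then show ?thesis using assms(5) by (simp add: comb_delta)
qed

lemma linear_flat_part:
  assumes "linear_op A" "linear_op T" "eigenbasis d T E s" "inj_on s {..d}"
  shows "linear_op (flat_part scale A T)"
  unfolding linear_op_iff flat_part_eigenbasis[OF assms] using eigenbasisD(1)[OF assms(3)]
  by (simp add: coord_add coord_scale comb_add comb_scale ring_distribs mult.left_commute)

text \<open>Both sides are the eigenvalue of the flat part on one and the same line.\<close>

lemma diagonal_entry_eq:
  assumes A: "linear_op A" and T: "linear_op T"
    and E: "eigenbasis d T E s" "inj_on s {..d}"
    and G: "eigenbasis d T G u" "inj_on u {..d}"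
    and ij: "i \<le> d" "j \<le> d" "s i = u j"
  shows "matrix_wrt scale d E A i i = matrix_wrt scale d G A j j"
proof -
  define c where "c = coord d E (G j) i"
  have Gj: "G j = c *s E i"
    unfolding c_def using eigenbasisD(2)[OF G(1) ij(2)] ij
    by (intro eigenvector_unique[OF T E]) auto
  then have "c *s flat_part scale A T (E i) = flat_part scale A T (G j)"
    using linear_flat_part[OF A T E] by (simp add: linear_op_scale)
  then have "matrix_wrt scale d E A i i *s G j = matrix_wrt scale d G A j j *s G j"
    using flat_part_eigenvector[OF A T E ij(1)] flat_part_eigenvector[OF A T G ij(2)] Gj
    by (simp add: mult.commute)
  then show ?thesis
    using ordered_basis_nonzero[OF eigenbasisD(1)[OF G(1)] ij(2)] by simp
qed

text \<open>Two eigenbases of an operator with simple spectrum differ by a permutation and a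
  rescaling. With nonzero scalars, such a change only relabels the pattern of nonzero
  entries.\<close>

lemma matrix_wrt_monomial_change:
  assumes A: "linear_op A" and E: "ordered_basis scale d E" and G: "ordered_basis scale d G"
    and \<sigma>: "bij_betw \<sigma> {..d} {..d}" and k: "\<And>j. j \<le> d \<Longrightarrow> G j = k j *s E (\<sigma> j)"
    and ij: "i \<le> d" "j \<le> d"
  shows "k i * matrix_wrt scale d G A i j = k j * matrix_wrt scale d E A (\<sigma> i) (\<sigma> j)"
proof -
  have \<sigma>d: "\<sigma> i \<le> d" if "i \<le> d" for i
    using \<sigma> that by (auto simp: bij_betw_def)
  have left: "coord d E (A (G j)) (\<sigma> i) = k j * matrix_wrt scale d E A (\<sigma> i) (\<sigma> j)"
    using A E ij by (simp add: k linear_op_scale coord_scale matrix_wrt_eq_coord)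
  have "coord d E (A (G j)) (\<sigma> i) =
      (\<Sum>l\<le>d. matrix_wrt scale d G A l j * (k l * (if \<sigma> i = \<sigma> l then 1 else 0)))"
    using E \<sigma>d ij by (subst matrix_wrt_column[OF G, of A])
      (simp add: comb_def coord_sum coord_scale k coord_basis mult.assoc)
  also have "\<dots> = (\<Sum>l\<le>d. if l = i then matrix_wrt scale d G A i j * k i else 0)"
    using \<sigma> ij by (intro sum.cong refl) (auto simp: bij_betw_def inj_on_def)
  finally show ?thesis
    using ij left by (simp add: mult.commute)
qed

end

section \<open>Standard orderings\<close>

text \<open>A step from \<open>n\<close> leads to \<open>n - 1\<close> or \<open>n + 1\<close>, and
  injectivity forbids a return to \<open>n - 1\<close>, which is already taken.\<close>

lemma path_automorphism_fixing_end:
  fixes \<sigma> :: "nat \<Rightarrow> nat"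
  assumes inj: "inj_on \<sigma> {..d}" and "\<sigma> 0 = 0"
    and adj: "\<And>i. i < d \<Longrightarrow> \<sigma> (Suc i) = Suc (\<sigma> i) \<or> \<sigma> i = Suc (\<sigma> (Suc i))"
    and "i \<le> d"
  shows "\<sigma> i = i"
  using \<open>i \<le> d\<close>
proof (induction i rule: less_induct)
  case (less i)
  show ?case
  proof (cases i)
    case (Suc n)
    have n: "\<sigma> n = n"
      using less.IH[of n] less.prems Suc by simp
    have False if "n = Suc (\<sigma> i)"
    proof -
      have "\<sigma> (n - 1) = n - 1"
        using less.IH[of "n - 1"] less.prems Suc by simp
      then have "\<sigma> (n - 1) = \<sigma> i"
        using that by simp
      then have "n - 1 = i"
        by (rule inj_onD[OF inj]) (use less.prems Suc in simp_all)
      then show False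
        using Suc by simp
    qed
    then show ?thesis
      using adj[of n] less.prems Suc n by auto
  qed (use \<open>\<sigma> 0 = 0\<close> in simp)
qed

text \<open>Endpoints have a single neighbour: if \<open>\<sigma> 0\<close> were interior, the
  preimages of its two neighbours would both be adjacent to 0 and hence both equal 1. The case
  \<open>\<sigma> 0 = d\<close> is reduced to the other one by reflecting the path.\<close>

lemma path_automorphism:
  fixes \<sigma> :: "nat \<Rightarrow> nat"
  assumes \<sigma>: "bij_betw \<sigma> {..d} {..d}"
    and adj: "\<And>i j. \<lbrakk>i \<le> d; j \<le> d\<rbrakk> \<Longrightarrow>
      (\<sigma> i = Suc (\<sigma> j) \<or> \<sigma> j = Suc (\<sigma> i)) \<longleftrightarrow> (i = Suc j \<or> j = Suc i)"
  shows "(\<forall>i\<le>d. \<sigma> i = i) \<or> (\<forall>i\<le>d. \<sigma> i = d - i)"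
proof -
  have inj: "inj_on \<sigma> {..d}" and img: "\<sigma> ` {..d} = {..d}"
    using \<sigma> by (auto simp: bij_betw_def)
  have le: "\<sigma> i \<le> d" if "i \<le> d" for i
    using img that by auto
  have "\<sigma> 0 = 0 \<or> \<sigma> 0 = d"
  proof (rule ccontr)
    assume "\<not> (\<sigma> 0 = 0 \<or> \<sigma> 0 = d)"
    then have *: "0 < \<sigma> 0" "\<sigma> 0 < d"
      using le[of 0] by auto
    then have "\<sigma> 0 - 1 \<in> \<sigma> ` {..d}" "Suc (\<sigma> 0) \<in> \<sigma> ` {..d}"
      by (auto simp: img)
    then obtain a b where ab: "a \<le> d" "b \<le> d" "\<sigma> 0 - 1 = \<sigma> a" "Suc (\<sigma> 0) = \<sigma> b"
      by (elim imageE) simp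
    then have "a = 1" "b = 1"
      using adj[of a 0] adj[of b 0] * by auto
    then show False
      using ab by simp
  qed
  then show ?thesis
  proof
    assume "\<sigma> 0 = 0"
    then have "\<sigma> i = i" if "i \<le> d" for i
    proof (rule path_automorphism_fixing_end[OF inj _ _ that])
      show "\<sigma> (Suc i) = Suc (\<sigma> i) \<or> \<sigma> i = Suc (\<sigma> (Suc i))" if "i < d" for i
        using adj[of i "Suc i"] that by auto
    qed
    then show ?thesis by blast
  next
    assume 0: "\<sigma> 0 = d"
    let ?\<tau> = "\<lambda>i. d - \<sigma> i"
    have "?\<tau> i = i" if "i \<le> d" for i
    proof (rule path_automorphism_fixing_end[of ?\<tau>, OF _ _ _ that])
      show "inj_on ?\<tau> {..d}"
      proof (rule inj_onI)
        fix i j assume ij: "i \<in> {..d}" "j \<in> {..d}" "d - \<sigma> i = d - \<sigma> j"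
        then have "\<sigma> i = \<sigma> j"
          using le[of i] le[of j] by auto
        then show "i = j"
          using inj_onD[OF inj] ij by blast
      qed
      show "d - \<sigma> (Suc i) = Suc (d - \<sigma> i) \<or> d - \<sigma> i = Suc (d - \<sigma> (Suc i))" if "i < d" for i
        using adj[of i "Suc i"] le[of i] le[of "Suc i"] that by auto
    qed (simp add: 0)
    then have "\<sigma> i = d - i" if "i \<le> d" for i
      using that le[OF that] by fastforce
    then show ?thesis by blast
  qed
qed

context coordinate_space
begin

lemma standard_orderingE:
  assumes "standard_ordering scale d A As th"
  obtains E where "eigenbasis d A E th" "irreducible_tridiagonal d (matrix_wrt scale d E As)"
    "inj_on th {..d}" "eigenvalues scale A = th ` {..d}"
  using assms by (auto simp: standard_ordering_def eigenbasis_def is_diag_iff bij_betw_def)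

lemma standard_orderingI:
  assumes "linear_op A" and E: "eigenbasis d A E th" and "inj_on th {..d}"
    and "irreducible_tridiagonal d (matrix_wrt scale d E As)"
  shows "standard_ordering scale d A As th"
  unfolding standard_ordering_def
  using assms eigenvalues_eigenbasis[OF assms(1) E]
  by (auto simp: is_diag_iff bij_betw_def eigenbasis_def)

lemma irreducible_tridiagonal_off_diagonal:
  assumes "irreducible_tridiagonal d M" "i \<le> d" "j \<le> d" "i \<noteq> j"
  shows "M i j \<noteq> 0 \<longleftrightarrow> i = Suc j \<or> j = Suc i"
  using assms unfolding irreducible_tridiagonal_def
  by (cases "i + 1 < j \<or> j + 1 < i") auto

lemma eigenbasis_change:
  assumes A: "linear_op A" and E: "eigenbasis d A E s" "inj_on s {..d}"
    and G: "eigenbasis d A G (\<lambda>j. s (\<sigma> j))" and \<sigma>: "\<And>j. j \<le> d \<Longrightarrow> \<sigma> j \<le> d"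
  obtains k where "\<And>j. j \<le> d \<Longrightarrow> G j = k j *s E (\<sigma> j)" "\<And>j. j \<le> d \<Longrightarrow> k j \<noteq> 0"
proof
  let ?k = "\<lambda>j. coord d E (G j) (\<sigma> j)"
  show *: "G j = ?k j *s E (\<sigma> j)" if "j \<le> d" for j
    using eigenvector_unique[OF A E eigenbasisD(2)[OF G that]] \<sigma> that by simp
  show "?k j \<noteq> 0" if "j \<le> d" for j
    using *[OF that] ordered_basis_nonzero[OF eigenbasisD(1)[OF G] that] by auto
qed

text \<open>Off the diagonal, the nonzero entries of an irreducible tridiagonal matrix form the
  adjacency relation of a path. The permutation relating two standard orderings preserves it, and a
  path has no automorphisms besides the identity and the reversal.\<close>

lemma standard_ordering_unique:
  assumes A: "linear_op A" and As: "linear_op As"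
    and th: "standard_ordering scale d A As th" and u: "standard_ordering scale d A As u"
  shows "(\<forall>i\<le>d. u i = th i) \<or> (\<forall>i\<le>d. u i = th (d - i))"
proof -
  obtain E where E: "eigenbasis d A E th" "irreducible_tridiagonal d (matrix_wrt scale d E As)"
    "inj_on th {..d}" "eigenvalues scale A = th ` {..d}"
    using th by (rule standard_orderingE)
  obtain G where G: "eigenbasis d A G u" "irreducible_tridiagonal d (matrix_wrt scale d G As)"
    "inj_on u {..d}" "eigenvalues scale A = u ` {..d}"
    using u by (rule standard_orderingE)
  define \<sigma> where "\<sigma> j = the_inv_into {..d} th (u j)" for j
  have u_mem: "u j \<in> th ` {..d}" if "j \<le> d" for j
    using that E(4) G(4) by auto
  have th\<sigma>: "th (\<sigma> j) = u j" and \<sigma>d: "\<sigma> j \<le> d" if "j \<le> d" for j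
    unfolding \<sigma>_def using f_the_inv_into_f[OF E(3) u_mem[OF that]]
      the_inv_into_into[OF E(3) u_mem[OF that] order_refl] by auto
  have "inj_on \<sigma> {..d}"
  proof (rule inj_onI)
    fix i j assume ij: "i \<in> {..d}" "j \<in> {..d}" "\<sigma> i = \<sigma> j"
    then have "u i = u j"
      using th\<sigma>[of i] th\<sigma>[of j] by simp
    then show "i = j"
      using inj_onD[OF G(3)] ij by blast
  qed
  then have \<sigma>: "bij_betw \<sigma> {..d} {..d}"
    using \<sigma>d endo_inj_surj[of "{..d}" \<sigma>] unfolding bij_betw_def
    by (metis (no_types, lifting) atMost_iff finite_atMost image_subsetI)
  have "eigenbasis d A G (\<lambda>j. th (\<sigma> j))"
    using G(1) th\<sigma> by (simp add: eigenbasis_def)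
  from eigenbasis_change[OF A E(1,3) this \<sigma>d]
  obtain k where k: "\<And>j. j \<le> d \<Longrightarrow> G j = k j *s E (\<sigma> j)" "\<And>j. j \<le> d \<Longrightarrow> k j \<noteq> 0"
    by blast
  have "(\<sigma> i = Suc (\<sigma> j) \<or> \<sigma> j = Suc (\<sigma> i)) \<longleftrightarrow> (i = Suc j \<or> j = Suc i)"
    if ij: "i \<le> d" "j \<le> d" for i j
  proof (cases "i = j")
    case False
    then have "\<sigma> i \<noteq> \<sigma> j"
      using \<sigma> ij by (auto simp: bij_betw_def inj_on_def)
    moreover have "k i * matrix_wrt scale d G As i j = k j * matrix_wrt scale d E As (\<sigma> i) (\<sigma> j)"
      by (rule matrix_wrt_monomial_change[OF As eigenbasisD(1)[OF E(1)] eigenbasisD(1)[OF G(1)]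
            \<sigma> k(1) ij])
    then have "matrix_wrt scale d G As i j \<noteq> 0 \<longleftrightarrow> matrix_wrt scale d E As (\<sigma> i) (\<sigma> j) \<noteq> 0"
      using k(2) ij by (metis mult_eq_0_iff)
    ultimately show ?thesis
      using irreducible_tridiagonal_off_diagonal[OF G(2) ij False]
        irreducible_tridiagonal_off_diagonal[OF E(2) \<sigma>d \<sigma>d] ij by simp
  qed auto
  from path_automorphism[OF \<sigma> this] show ?thesis
    using th\<sigma> by metis
qed


section \<open>Split bases\<close>

definition split_basis :: "nat \<Rightarrow> ('b \<Rightarrow> 'b) \<Rightarrow> ('b \<Rightarrow> 'b) \<Rightarrow> (nat \<Rightarrow> 'a) \<Rightarrow> (nat \<Rightarrow> 'a) \<Rightarrow>
    (nat \<Rightarrow> 'a) \<Rightarrow> (nat \<Rightarrow> 'b) \<Rightarrow> bool" where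
  "split_basis d A As th ths ph v \<longleftrightarrow> ordered_basis scale d v \<and>
     is_lower_bidiagonal d th (matrix_wrt scale d v A) \<and>
     is_upper_bidiagonal d ths ph (matrix_wrt scale d v As)"

lemma split_basisD:
  assumes "split_basis d A As th ths ph v"
  shows "ordered_basis scale d v" "is_lower_bidiagonal d th (matrix_wrt scale d v A)"
    "is_upper_bidiagonal d ths ph (matrix_wrt scale d v As)"
  using assms by (simp_all add: split_basis_def)

lemma split_basis_lower_coord:
  assumes "linear_op A" and v: "split_basis d A As th ths ph v" and "i \<le> d"
  shows "coord d v (A x) i = th i * coord d v x i + (if i = 0 then 0 else coord d v x (i - 1))"
proof -
  note v = split_basisD[OF v]
  have "coord d v (A (comb d v (coord d v x))) i =
      th i * coord d v x i + (if i = 0 then 0 else coord d v x (i - 1))"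
    unfolding lower_bidiagonal_comb[OF assms(1) v(1,2)] by (rule coord_comb[OF v(1) assms(3)])
  then show ?thesis
    using v(1) by (simp only: comb_coord)
qed

lemma split_basis_upper_coord:
  assumes "linear_op As" and v: "split_basis d A As th ths ph v" and "i \<le> d"
  shows "coord d v (As x) i =
    ths i * coord d v x i + (if i = d then 0 else ph (i + 1) * coord d v x (i + 1))"
proof -
  note v = split_basisD[OF v]
  have "coord d v (As (comb d v (coord d v x))) i =
      ths i * coord d v x i + (if i = d then 0 else ph (i + 1) * coord d v x (i + 1))"
    unfolding upper_bidiagonal_comb[OF assms(1) v(1,3)] by (rule coord_comb[OF v(1) assms(3)])
  then show ?thesis
    using v(1) by (simp only: comb_coord)
qed

text \<open>Otherwise the zeroth coordinate functional would be a common left eigenvector of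
  \<open>A\<close> and \<open>As\<close>, contradicting irreducibility.\<close>

lemma split_sequence_first_nonzero:
  assumes A: "linear_op A" and As: "linear_op As" and "0 < d"
    and w: "eigenbasis d A w t" "inj_on t {..d}"
    and M: "irreducible_tridiagonal d (matrix_wrt scale d w As)"
    and v: "split_basis d A As th ths ph v" and k: "k \<le> d" "th 0 = t k"
  shows "ph 1 \<noteq> 0"
proof
  assume ph: "ph 1 = 0"
  note vb = split_basisD(1)[OF v] and wb = eigenbasisD(1)[OF w(1)]
  let ?f = "\<lambda>x. coord d v x 0"
  have zero: "?f (w j) = 0" if "j \<le> d" "j \<noteq> k" for j
  proof -
    have "t j * ?f (w j) = t k * ?f (w j)"
      using split_basis_lower_coord[OF A v, of 0 "w j"] eigenbasisD(2)[OF w(1) that(1)] k(2)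
      by (simp add: coord_scale[OF vb])
    moreover have "t j \<noteq> t k"
      using inj_onD[OF w(2), of j k] that k(1) by auto
    ultimately show ?thesis
      by (metis mult_right_cancel)
  qed
  have expand: "?f x = coord d w x k * ?f (w k)" for x
  proof -
    have "?f x = ?f (comb d w (coord d w x))"
      using wb by (simp add: comb_coord)
    also have "\<dots> = (\<Sum>j\<le>d. coord d w x j * ?f (w j))"
      unfolding comb_def by (simp add: coord_sum[OF vb] coord_scale[OF vb])
    also have "\<dots> = (\<Sum>j\<le>d. if j = k then coord d w x k * ?f (w k) else 0)"
      using zero by (intro sum.cong) auto
    finally show ?thesis using k(1) by simp
  qed
  \<comment> \<open>A neighbour of \<open>k\<close>, on whichever side one exists. With
    \<open>ph 1 = 0\<close> the functional vanishes on \<open>As (w m)\<close>, although this vector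
    has a nonzero component along \<open>w k\<close>.\<close>
  define m where "m = (if k < d then k + 1 else k - 1)"
  have m: "m \<le> d" "m \<noteq> k" "k = Suc m \<or> m = Suc k"
    using k \<open>0 < d\<close> by (auto simp: m_def)
  have "?f (As (w m)) = 0"
    using split_basis_upper_coord[OF As v, of 0 "w m"] ph zero[OF m(1,2)] by simp
  then have "matrix_wrt scale d w As k m * ?f (w k) = 0"
    using expand[of "As (w m)"] by (simp add: matrix_wrt_eq_coord)
  then have "?f (w k) = 0"
    using irreducible_tridiagonal_off_diagonal[OF M k(1) m(1) m(2)[symmetric]] m(3) by simp
  then have "?f (v 0) = 0"
    using expand[of "v 0"] by simp
  then show False
    using coord_basis[OF vb, of 0 0] by simp
qed

lemma split_basis_eigenbasis_As:
  assumes As: "linear_op As" and v: "split_basis d A As th ths ph v"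
    and diag: "\<And>j. j \<le> d \<Longrightarrow> c j j = 1" and upper: "\<And>i j. j < i \<Longrightarrow> c i j = 0"
    and c: "\<And>i j. \<lbrakk>i < j; j \<le> d\<rbrakk> \<Longrightarrow> (ths j - ths i) * c i j = ph (Suc i) * c (Suc i) j"
  shows "eigenbasis d As (\<lambda>j. comb d v (\<lambda>i. c i j)) ths"
  unfolding eigenbasis_def
proof (intro conjI allI impI)
  note v = split_basisD[OF v]
  show "ordered_basis scale d (\<lambda>j. comb d v (\<lambda>i. c i j))"
  proof (rule ordered_basis_triangularI[OF v(1), where r = "\<lambda>i. i"])
    show "i < j" if "i \<noteq> j" "c i j \<noteq> 0" for i j
      using upper[of j i] that by (cases i j rule: linorder_cases) simp_all
  qed (rule diag)
  fix j assume j: "j \<le> d"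
  show "As (comb d v (\<lambda>i. c i j)) = ths j *s comb d v (\<lambda>i. c i j)"
    unfolding upper_bidiagonal_comb[OF As v(1,3)] comb_scale
  proof (rule comb_cong)
    fix i assume i: "i \<le> d"
    show "ths i * c i j + (if i = d then 0 else ph (i + 1) * c (i + 1) j) = ths j * c i j"
    proof (cases i j rule: linorder_cases)
      case less
      then show ?thesis
        using c[OF less j] j by (auto simp: algebra_simps)
    qed (use i upper in auto)
  qed
qed

text \<open>The change from \<open>v\<close> to \<open>E\<close> is upper unitriangular, so it is
  transparent at the two ends: \<open>E 0\<close> is \<open>v 0\<close>, and the last coordinates
  with respect to \<open>E\<close> and \<open>v\<close> coincide. Hence the end diagonal entries of
  \<open>A\<close> can be read off from the split form.\<close>

lemma split_basis_end_entries:
  assumes A: "linear_op A" and As: "linear_op As" and "0 < d"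
    and inj: "inj_on ths {..d}" and v: "split_basis d A As th ths ph v"
  obtains E where "eigenbasis d As E ths"
    "ph 1 = (matrix_wrt scale d E A 0 0 - th 0) * (ths 0 - ths 1)"
    "ph d = (matrix_wrt scale d E A d d - th d) * (ths d - ths (d - 1))"
proof -
  note vb = split_basisD[OF v]
  \<comment> \<open>Closed form of the eigenvector recurrence \<open>rec\<close> below, normalised
    by \<open>c j j = 1\<close>.\<close>
  define c where
    "c i j = (if i \<le> j then \<Prod>k\<in>{i<..j}. ph k / (ths j - ths (k - 1)) else 0)" for i j
  let ?E = "\<lambda>j. comb d v (\<lambda>i. c i j)"
  have diag: "c j j = 1" for j
    by (simp add: c_def)
  have upper: "c i j = 0" if "j < i" for i j
    using that by (simp add: c_def)
  have ne: "ths j - ths i \<noteq> 0" if "i < j" "j \<le> d" for i j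
    using inj_onD[OF inj, of i j] that by auto
  have rec: "(ths j - ths i) * c i j = ph (Suc i) * c (Suc i) j" if "i < j" "j \<le> d" for i j
  proof -
    have "{i<..j} = insert (Suc i) {Suc i<..j}"
      using that by auto
    then have "c i j = ph (Suc i) / (ths j - ths i) * c (Suc i) j"
      using that by (simp add: c_def)
    then show ?thesis
      using ne[OF that] by simp
  qed
  have E: "eigenbasis d As ?E ths"
    by (rule split_basis_eigenbasis_As[OF As v diag upper rec])
  note Eb = eigenbasisD(1)[OF E]
  have "A (?E 0) = (th 0 - c 0 1) *s ?E 0 + 1 *s ?E 1"
    unfolding lower_bidiagonal_comb[OF A vb(1,2)] comb_scale comb_add
  proof (rule comb_cong)
    fix i assume "i \<le> d"
    consider "i = 0" | "i = 1" | "i > 1" by linarith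
    then show "th i * c i 0 + (if i = 0 then 0 else c (i - 1) 0) =
        (th 0 - c 0 1) * c i 0 + 1 * c i 1"
      by cases (auto simp: diag upper algebra_simps)
  qed
  then have a0: "matrix_wrt scale d ?E A 0 0 = th 0 - c 0 1"
    using \<open>0 < d\<close> coord_basis[OF Eb, of 0 0] coord_basis[OF Eb, of 0 1]
    by (simp add: matrix_wrt_eq_coord coord_add[OF Eb] coord_scale[OF Eb])
  then have first: "ph 1 = (matrix_wrt scale d ?E A 0 0 - th 0) * (ths 0 - ths 1)"
    unfolding a0 using rec[of 0 1] \<open>0 < d\<close> by (simp add: diag algebra_simps)
  have top: "coord d ?E x d = coord d v x d" for x
  proof -
    have "coord d v x d = coord d v (comb d ?E (coord d ?E x)) d"
      using Eb by (simp add: comb_coord)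
    also have "\<dots> = (\<Sum>j\<le>d. coord d ?E x j * c d j)"
      unfolding comb_def[of d ?E] using vb(1) by (simp add: coord_sum coord_scale coord_comb)
    also have "\<dots> = (\<Sum>j\<le>d. if j = d then coord d ?E x d else 0)"
      by (intro sum.cong) (auto simp: diag upper)
    finally show ?thesis by simp
  qed
  have ad: "matrix_wrt scale d ?E A d d = th d + c (d - 1) d"
    using \<open>0 < d\<close> split_basis_lower_coord[OF A v, of d "?E d"] vb(1)
    by (simp add: matrix_wrt_eq_coord top coord_comb diag)
  have "ph d = (matrix_wrt scale d ?E A d d - th d) * (ths d - ths (d - 1))"
    unfolding ad using rec[of "d - 1" d] \<open>0 < d\<close> by (simp add: diag algebra_simps)
  with E first that show thesis by blast
qed

text \<open>The eigenvector \<open>W j\<close> lies in the span of \<open>v j, ..., v d\<close>. As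
  \<open>As\<close> lowers an index by at most one, \<open>As (W j)\<close> starts at
  \<open>v (j - 1)\<close>, with coefficient \<open>ph j\<close>; this settles the entries above the
  diagonal.\<close>

lemma split_basis_eigenbasis_A:
  assumes A: "linear_op A" and As: "linear_op As"
    and inj: "inj_on th {..d}" and v: "split_basis d A As th ths ph v"
    and ph: "\<And>i. i \<in> {1..d} \<Longrightarrow> ph i \<noteq> 0"
  obtains W where "eigenbasis d A W th"
    "\<And>i j. \<lbrakk>i + 1 < j; j \<le> d\<rbrakk> \<Longrightarrow> matrix_wrt scale d W As i j = 0"
    "\<And>i. i < d \<Longrightarrow> matrix_wrt scale d W As i (i + 1) \<noteq> 0"
proof -
  note vb = split_basisD[OF v]
  define w where "w i j = (if j \<le> i then \<Prod>k\<in>{j<..i}. 1 / (th j - th k) else 0)" for i j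
  let ?W = "\<lambda>j. comb d v (\<lambda>i. w i j)"
  have diag: "w j j = 1" for j
    by (simp add: w_def)
  have lower: "w i j = 0" if "i < j" for i j
    using that by (simp add: w_def)
  have rec: "w (i - 1) j = (th j - th i) * w i j" if "j < i" "i \<le> d" for i j
  proof -
    have "{j<..i} = insert i {j<..i - 1}"
      using that by auto
    moreover have "j \<le> i - 1"
      using that by linarith
    ultimately have "w i j = 1 / (th j - th i) * w (i - 1) j"
      using that by (simp add: w_def)
    moreover have "th j - th i \<noteq> 0"
      using inj_onD[OF inj, of i j] that by auto
    ultimately show ?thesis by simp
  qed
  have Wb: "ordered_basis scale d ?W"
  proof (rule ordered_basis_triangularI[OF vb(1), where r = "\<lambda>i. d - i"])
    show "d - i < d - j" if "i \<le> d" "j \<le> d" "i \<noteq> j" "w i j \<noteq> 0" for i j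
      using lower[of i j] that by (cases i j rule: linorder_cases) simp_all
  qed (rule diag)
  have W: "eigenbasis d A ?W th"
    unfolding eigenbasis_def
  proof (intro conjI allI impI Wb)
    fix j assume j: "j \<le> d"
    show "A (?W j) = th j *s ?W j"
      unfolding lower_bidiagonal_comb[OF A vb(1,2)] comb_scale
    proof (rule comb_cong)
      fix i assume i: "i \<le> d"
      show "th i * w i j + (if i = 0 then 0 else w (i - 1) j) = th j * w i j"
      proof (cases i j rule: linorder_cases)
        case greater
        then show ?thesis
          using rec[OF greater i] by (simp add: algebra_simps)
      qed (use lower in auto)
    qed
  qed
  let ?M = "matrix_wrt scale d ?W As"
  \<comment> \<open>The change to \<open>?W\<close> is lower unitriangular: once the entries of a
    column before \<open>i\<close> vanish, entry \<open>i\<close> equals the coordinate with respect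
    to \<open>v\<close>.\<close>
  have coord_M: "coord d v (As (?W j)) i = ?M i j"
    if "i \<le> d" and "\<And>k. k < i \<Longrightarrow> ?M k j = 0" for i j
  proof -
    have "coord d v (As (?W j)) i = (\<Sum>k\<le>d. ?M k j * w i k)"
      using vb(1) that(1) by (subst matrix_wrt_column[OF Wb, of As])
        (simp add: comb_def[of d ?W] coord_sum coord_scale coord_comb)
    also have "\<dots> = (\<Sum>k\<le>d. if k = i then ?M i j else 0)"
    proof (intro sum.cong refl)
      fix k
      show "?M k j * w i k = (if k = i then ?M i j else 0)"
        using that(2)[of k] lower[of i k] diag[of i] by (cases k i rule: linorder_cases) auto
    qed
    finally show ?thesis using that(1) by simp
  qed
  have coord_W: "coord d v (As (?W j)) i =
      ths i * w i j + (if i = d then 0 else ph (i + 1) * w (i + 1) j)" if "i \<le> d" for i j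
    using split_basis_upper_coord[OF As v that, of "?W j"] vb(1) that by (simp add: coord_comb)
  have zero: "?M i j = 0" if "i + 1 < j" "j \<le> d" for i j
    using that
  proof (induction i rule: less_induct)
    case (less i)
    then have "?M i j = coord d v (As (?W j)) i"
      by (intro coord_M[symmetric]) auto
    then show ?case
      using coord_W[of i j] lower less.prems by simp
  qed
  moreover have "?M i (i + 1) \<noteq> 0" if "i < d" for i
  proof -
    have "?M i (i + 1) = coord d v (As (?W (i + 1))) i"
      using zero that by (intro coord_M[symmetric]) auto
    also have "\<dots> = ph (i + 1)"
      using coord_W[of i "i + 1"] lower diag that by simp
    finally show ?thesis
      using ph that by simp
  qed
  ultimately show thesis
    using W that by blast
qed

text \<open>The two split decompositions give the two halves of tridiagonality.\<close>

lemma standard_ordering_of_split_bases: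
  assumes A: "linear_op A" and As: "linear_op As" and inj: "inj_on th {..d}"
    and v: "split_basis d A As th ths ph v" "\<And>i. i \<in> {1..d} \<Longrightarrow> ph i \<noteq> 0"
    and u: "split_basis d A As (\<lambda>i. th (d - i)) ths' ph' u" "\<And>i. i \<in> {1..d} \<Longrightarrow> ph' i \<noteq> 0"
  shows "standard_ordering scale d A As th"
proof -
  obtain W where W: "eigenbasis d A W th"
    "\<And>i j. \<lbrakk>i + 1 < j; j \<le> d\<rbrakk> \<Longrightarrow> matrix_wrt scale d W As i j = 0"
    "\<And>i. i < d \<Longrightarrow> matrix_wrt scale d W As i (i + 1) \<noteq> 0"
    using split_basis_eigenbasis_A[OF A As inj v] by blast
  have inj': "inj_on (\<lambda>i. th (d - i)) {..d}"
  proof (rule inj_onI)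
    fix i j assume ij: "i \<in> {..d}" "j \<in> {..d}" "th (d - i) = th (d - j)"
    then have "d - i = d - j"
      by (intro inj_onD[OF inj]) auto
    then show "i = j"
      using ij by auto
  qed
  obtain U where U: "eigenbasis d A U (\<lambda>i. th (d - i))"
    "\<And>i j. \<lbrakk>i + 1 < j; j \<le> d\<rbrakk> \<Longrightarrow> matrix_wrt scale d U As i j = 0"
    "\<And>i. i < d \<Longrightarrow> matrix_wrt scale d U As i (i + 1) \<noteq> 0"
    using split_basis_eigenbasis_A[OF A As inj' u] by blast
  obtain k where k: "\<And>j. j \<le> d \<Longrightarrow> U j = k j *s W (d - j)" "\<And>j. j \<le> d \<Longrightarrow> k j \<noteq> 0"
    by (rule eigenbasis_change[OF A W(1) inj U(1) diff_le_self]) (rule that)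
  have rev: "bij_betw (\<lambda>j. d - j) {..d} {..d}"
    by (rule bij_betw_byWitness[where f' = "\<lambda>j. d - j"]) auto
  \<comment> \<open>\<open>U\<close> lists the eigenlines of \<open>W\<close> in reverse order, so
    vanishing above the superdiagonal for \<open>U\<close> is vanishing below the subdiagonal for
    \<open>W\<close>.\<close>
  have M: "k i * matrix_wrt scale d U As i j = k j * matrix_wrt scale d W As (d - i) (d - j)"
    if "i \<le> d" "j \<le> d" for i j
    by (rule matrix_wrt_monomial_change[OF As eigenbasisD(1)[OF W(1)] eigenbasisD(1)[OF U(1)]
          rev k(1) that])
  have "irreducible_tridiagonal d (matrix_wrt scale d W As)"
    unfolding irreducible_tridiagonal_def
  proof (intro conjI allI impI)
    fix i j assume ij: "i \<le> d" "j \<le> d" "i + 1 < j \<or> j + 1 < i"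
    show "matrix_wrt scale d W As i j = 0"
    proof (cases "i + 1 < j")
      case False
      then have "matrix_wrt scale d U As (d - i) (d - j) = 0"
        using ij by (intro U(2)) auto
      then show ?thesis
        using M[of "d - i" "d - j"] k(2)[of "d - j"] ij by simp
    qed (use W(2) ij in auto)
  next
    fix i assume i: "i < d"
    then have "matrix_wrt scale d U As (d - (i + 1)) (d - i) \<noteq> 0"
      using U(3)[of "d - (i + 1)"] by (simp add: Suc_diff_Suc)
    then show "matrix_wrt scale d W As (i + 1) i \<noteq> 0"
      using M[of "d - (i + 1)" "d - i"] k(2)[of "d - (i + 1)"] i by auto
    show "matrix_wrt scale d W As i (i + 1) \<noteq> 0"
      using W(3) i by simp
  qed
  with A W(1) inj show ?thesis
    by (intro standard_orderingI) auto
qed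

end

section \<open>The split form of dual $q$-Krawtchouk type\<close>

text \<open>The split sequence is \<open>ms * p ^ (i - 1)\<close> times this factor; the sign is
  that of the term \<open>- \<mu> * \<mu>s\<close> in the general formula. The factor vanishes at
  \<open>0\<close> and at \<open>d + 1\<close>, which absorbs boundary cases below.\<close>

definition kraw_factor :: "nat \<Rightarrow> 'a::field \<Rightarrow> 'a \<Rightarrow> nat \<Rightarrow> 'a" where
  "kraw_factor d p m k = - m * (p ^ k - 1) * (p ^ (d + 1 - k) - 1)"

text \<open>Solution, with 1 on the diagonal, of the recurrence for eigenvectors of
  \<open>As\<close> in the split basis. The common factor \<open>ms * p ^ i\<close> of both sides
  cancels, so that apart from \<open>d\<close> and \<open>p\<close> only \<open>m\<close>
  remains.\<close>

definition kraw_coeff :: "nat \<Rightarrow> 'a::field \<Rightarrow> 'a \<Rightarrow> nat \<Rightarrow> nat \<Rightarrow> 'a" where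
  "kraw_coeff d p m i j =
     (if i \<le> j then (\<Prod>k\<in>{i<..j}. kraw_factor d p m k) / (\<Prod>l\<in>{1..j - i}. p ^ l - 1) else 0)"

definition kraw_diag :: "nat \<Rightarrow> 'a::field \<Rightarrow> 'a \<Rightarrow> 'a \<Rightarrow> 'a \<Rightarrow> nat \<Rightarrow> 'a" where
  "kraw_diag d p \<delta> m n j = \<delta> + (n + m * p ^ d) / p ^ j"

text \<open>The superdiagonal entries, which are the products of opposite off-diagonal entries since
  the subdiagonal is 1. For \<open>c = m * n\<close> they equal
  \<open>n / p ^ j * kraw_factor d p m j\<close>: the \<open>m\<close> of the split sequence meets
  the \<open>n\<close> of the eigenvalues.\<close>

definition kraw_prod :: "nat \<Rightarrow> 'a::field \<Rightarrow> 'a \<Rightarrow> nat \<Rightarrow> 'a" where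
  "kraw_prod d p c j = - c * (p ^ j - 1) * (p ^ (d + 1 - j) - 1) / p ^ j"

lemma kraw_coeff_diag: "kraw_coeff d p m j j = 1"
  by (simp add: kraw_coeff_def)

lemma kraw_coeff_upper: "j < i \<Longrightarrow> kraw_coeff d p m i j = 0"
  by (simp add: kraw_coeff_def)

lemma kraw_coeff_Suc_left:
  assumes "i < j"
  shows "kraw_coeff d p m i j = kraw_coeff d p m (Suc i) j * kraw_factor d p m (Suc i) / (p ^ (j - i) - 1)"
proof -
  have "{i<..j} = insert (Suc i) {Suc i<..j}"
    using assms by auto
  moreover obtain k where "j - Suc i = k" "j - i = Suc k"
    using assms by (metis Suc_diff_Suc)
  moreover have "{1..Suc k} = insert (Suc k) {1..k}"
    by auto
  ultimately show ?thesis
    using assms by (simp add: kraw_coeff_def mult_ac)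
qed

lemma kraw_coeff_Suc_right:
  assumes "i \<le> j"
  shows "kraw_coeff d p m i (Suc j) = kraw_coeff d p m i j * kraw_factor d p m (Suc j) / (p ^ (Suc j - i) - 1)"
proof -
  have "{i<..Suc j} = insert (Suc j) {i<..j}"
    using assms by auto
  moreover have "{1..Suc j - i} = insert (Suc j - i) {1..j - i}"
    using assms by auto
  ultimately show ?thesis
    using assms by (simp add: kraw_coeff_def Suc_diff_le mult_ac)
qed

text \<open>The difference of the numerators is divisible by \<open>p ^ (Suc j - i) - 1\<close>. For
  \<open>i = 0\<close> and \<open>j = d\<close> this denominator is \<open>p ^ (d + 1) - 1\<close>,
  which may be zero; both numerators vanish then, so the quotients are 0 in any case.\<close>

lemma kraw_factor_diff:
  fixes p :: "'a::field"
  assumes "p \<noteq> 0" "i \<le> j" "j \<le> d" and root: "\<forall>l\<in>{1..d}. p ^ l \<noteq> 1"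
  shows "kraw_factor d p m i / (p ^ (Suc j - i) - 1) - kraw_factor d p m (Suc j) / (p ^ (Suc j - i) - 1) =
    (if i = 0 \<and> j = d then 0 else - m * (p ^ i - p ^ (d - j)))"
proof (cases "i = 0 \<and> j = d")
  case False
  obtain f where f: "j = i + f"
    using assms(2) le_Suc_ex by blast
  obtain e where e: "d = j + e"
    using assms(3) le_Suc_ex by blast
  have eqs: "Suc j - i = Suc f" "d + 1 - i = Suc (f + e)" "d + 1 - Suc j = e" "d - j = e"
    by (simp_all add: f e)
  have pj: "p ^ Suc j = p ^ i * p ^ Suc f"
    by (simp add: f power_add)
  have "p ^ Suc f \<noteq> 1"
    using False f e by (intro bspec[OF root]) auto
  moreover have "kraw_factor d p m i - kraw_factor d p m (Suc j) = - m * (p ^ i - p ^ e) * (p ^ Suc f - 1)"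
    unfolding kraw_factor_def eqs pj by (simp add: power_add algebra_simps)
  ultimately show ?thesis
    unfolding eqs if_not_P[OF False] by (simp add: diff_divide_distrib[symmetric])
qed (simp add: kraw_factor_def)

text \<open>The coefficientwise form of the three-term recurrence satisfied by the eigenvectors
  of the upper bidiagonal matrix.\<close>

lemma kraw_coeff_recurrence:
  fixes p :: "'a::field"
  assumes p: "p \<noteq> 0" and root: "\<forall>l\<in>{1..d}. p ^ l \<noteq> 1" and i: "i \<le> d" and j: "j \<le> d"
  shows "(\<delta> + m * p ^ i + n / p ^ i) * kraw_coeff d p m i j + (if i = 0 then 0 else kraw_coeff d p m (i - 1) j) =
    (if j = d then 0 else kraw_coeff d p m i (Suc j)) + kraw_diag d p \<delta> m n j * kraw_coeff d p m i j +
    (if j = 0 then 0 else kraw_prod d p (m * n) j * kraw_coeff d p m i (j - 1))"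
proof (cases i "Suc j" rule: linorder_cases)
  case less
  then have ij: "i \<le> j" by simp
  let ?c = "kraw_coeff d p m i j" and ?Q = "p ^ (Suc j - i) - 1"
  \<comment> \<open>Each neighbouring term becomes a multiple of \<open>?c\<close>, which reduces
    the recurrence to the scalar identity \<open>key\<close>. The boundary cases fit in because
    \<open>kraw_factor\<close> vanishes at \<open>0\<close> and at \<open>d + 1\<close>.\<close>
  have left: "(if i = 0 then 0 else kraw_coeff d p m (i - 1) j) = ?c * (kraw_factor d p m i / ?Q)"
  proof (cases i)
    case (Suc k)
    then have "Suc j - i = j - k"
      using ij by simp
    then show ?thesis
      using kraw_coeff_Suc_left[of k j d p m] ij Suc by simp
  qed (simp add: kraw_factor_def)
  have right: "(if j = d then 0 else kraw_coeff d p m i (Suc j)) = ?c * (kraw_factor d p m (Suc j) / ?Q)"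
    using kraw_coeff_Suc_right[OF ij, of d p m] by (simp add: kraw_factor_def)
  have low: "(if j = 0 then 0 else kraw_prod d p (m * n) j * kraw_coeff d p m i (j - 1)) =
      ?c * (n / p ^ j * (p ^ (j - i) - 1))"
  proof (cases "i = j")
    case False
    then obtain k where k: "j = Suc k" "i \<le> k"
      using ij by (cases j) auto
    have "j - i \<in> {1..d}"
      using j k by auto
    with root have "p ^ (j - i) - 1 \<noteq> 0"
      by simp
    then have "?c * (p ^ (j - i) - 1) = kraw_coeff d p m i (j - 1) * kraw_factor d p m j"
      using kraw_coeff_Suc_right[OF k(2), of d p m] k(1) by simp
    moreover have "kraw_prod d p (m * n) j = n / p ^ j * kraw_factor d p m j"
      by (simp add: kraw_prod_def kraw_factor_def)
    ultimately show ?thesis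
      using k(1) by (simp add: mult_ac)
  qed (simp add: kraw_coeff_upper)
  have key: "\<delta> + m * p ^ i + n / p ^ i +
      (kraw_factor d p m i / ?Q - kraw_factor d p m (Suc j) / ?Q) =
      kraw_diag d p \<delta> m n j + n / p ^ j * (p ^ (j - i) - 1)"
  proof -
    obtain f where f: "j = i + f"
      using ij le_Suc_ex by blast
    obtain e where e: "d = j + e"
      using j le_Suc_ex by blast
    have "n / p ^ j * (p ^ (j - i) - 1) = n / p ^ i - n / p ^ j"
      using p by (simp add: f power_add field_simps)
    moreover have "(n + m * p ^ d) / p ^ j = n / p ^ j + m * p ^ (d - j)"
      using p by (simp add: e power_add field_simps)
    ultimately show ?thesis
      using kraw_factor_diff[OF p ij j root, of m] p unfolding kraw_diag_def
      by (auto simp: algebra_simps split: if_splits)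
  qed
  show ?thesis
    unfolding left right low using arg_cong[OF key, of "\<lambda>t. ?c * t"]
    by (simp add: algebra_simps)
next
  case equal
  then show ?thesis
    using i by (simp add: kraw_coeff_diag kraw_coeff_upper)
next
  case greater
  then show ?thesis
    by (simp add: kraw_coeff_upper)
qed

context coordinate_space
begin

text \<open>The parameters of the dual $q$-Krawtchouk split form, with \<open>p = q\<^sup>2\<close> and the powers of
  \<open>q\<close> that do not depend on \<open>i\<close> absorbed into \<open>m\<close>, \<open>n\<close>, \<open>ms\<close>.\<close>

definition kraw_split ::
  "nat \<Rightarrow> 'a \<Rightarrow> 'a \<Rightarrow> 'a \<Rightarrow> 'a \<Rightarrow> 'a \<Rightarrow> 'a \<Rightarrow> (nat \<Rightarrow> 'a) \<Rightarrow> (nat \<Rightarrow> 'a) \<Rightarrow> (nat \<Rightarrow> 'a) \<Rightarrow> bool" where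
  "kraw_split d p \<delta> m n \<delta>s ms th ths ph \<longleftrightarrow>
     (\<forall>i\<le>d. th i = \<delta> + m * p ^ i + n / p ^ i) \<and>
     (\<forall>i\<le>d. ths i = \<delta>s + ms * p ^ i) \<and>
     (\<forall>i\<in>{1..d}. ph i = ms * p ^ (i - 1) * kraw_factor d p m i)"

definition kraw_tridiagonal ::
  "nat \<Rightarrow> 'a \<Rightarrow> 'a \<Rightarrow> 'a \<Rightarrow> 'a \<Rightarrow> ('b \<Rightarrow> 'b) \<Rightarrow> (nat \<Rightarrow> 'b) \<Rightarrow> bool" where
  "kraw_tridiagonal d p \<delta> m n A E \<longleftrightarrow>
     (\<forall>j\<le>d. A (E j) = (if j = d then 0 else E (Suc j)) + kraw_diag d p \<delta> m n j *s E j +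
        (if j = 0 then 0 else kraw_prod d p (m * n) j *s E (j - 1)))"

text \<open>Stated for arbitrary operators with such a split basis, so that it also covers the model
  operators by which it is reversed below.\<close>

lemma split_basis_kraw_tridiagonal:
  assumes A: "linear_op A" and As: "linear_op As" and v: "split_basis d A As th ths ph v"
    and p: "p \<noteq> 0" and root: "\<forall>l\<in>{1..d}. p ^ l \<noteq> 1"
    and K: "kraw_split d p \<delta> m n \<delta>s ms th ths ph"
  defines "E \<equiv> \<lambda>j. comb d v (\<lambda>i. kraw_coeff d p m i j)"
  shows "eigenbasis d As E ths" "kraw_tridiagonal d p \<delta> m n A E"
proof -
  note vb = split_basisD[OF v]
  show "eigenbasis d As E ths"
    unfolding E_def
  proof (rule split_basis_eigenbasis_As[OF As v])
    fix i j assume ij: "i < j" "j \<le> d"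
    have "j - i \<in> {1..d}"
      using ij by auto
    with root have "p ^ (j - i) - 1 \<noteq> 0"
      by simp
    then have "kraw_coeff d p m i j * (p ^ (j - i) - 1) = kraw_coeff d p m (Suc i) j * kraw_factor d p m (Suc i)"
      using kraw_coeff_Suc_left[OF ij(1), of d p m] by simp
    moreover have "ths j - ths i = ms * p ^ i * (p ^ (j - i) - 1)"
      using K ij by (simp add: kraw_split_def algebra_simps power_add[symmetric])
    moreover have "ph (Suc i) = ms * p ^ i * kraw_factor d p m (Suc i)"
      using K ij by (simp add: kraw_split_def)
    ultimately show "(ths j - ths i) * kraw_coeff d p m i j = ph (Suc i) * kraw_coeff d p m (Suc i) j"
      by (simp add: mult_ac)
  qed (simp_all add: kraw_coeff_diag kraw_coeff_upper)
  show "kraw_tridiagonal d p \<delta> m n A E"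
    unfolding kraw_tridiagonal_def
  proof (intro allI impI)
    fix j assume j: "j \<le> d"
    have "(if j = d then 0 else E (Suc j)) = comb d v (\<lambda>i. if j = d then 0 else kraw_coeff d p m i (Suc j))"
      "(if j = 0 then 0 else kraw_prod d p (m * n) j *s E (j - 1)) =
        comb d v (\<lambda>i. if j = 0 then 0 else kraw_prod d p (m * n) j * kraw_coeff d p m i (j - 1))"
      by (simp_all add: E_def comb_zero comb_scale)
    moreover have "A (E j) = comb d v (\<lambda>i. (\<delta> + m * p ^ i + n / p ^ i) * kraw_coeff d p m i j +
        (if i = 0 then 0 else kraw_coeff d p m (i - 1) j))"
      unfolding E_def lower_bidiagonal_comb[OF A vb(1,2)]
      using K by (intro comb_cong) (simp add: kraw_split_def)
    ultimately show "A (E j) = (if j = d then 0 else E (Suc j)) + kraw_diag d p \<delta> m n j *s E j +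
        (if j = 0 then 0 else kraw_prod d p (m * n) j *s E (j - 1))"
      by (simp only: E_def comb_scale comb_add)
        (rule comb_cong, rule kraw_coeff_recurrence[OF p root _ j])
  qed
qed

text \<open>Comparison with a model: \<open>L\<close> and \<open>U\<close> are defined on
  \<open>v\<close> by the desired bidiagonal matrices, \<open>split_basis_kraw_tridiagonal\<close>
  computes their action on \<open>E\<close>, and this is the action of \<open>B\<close> and
  \<open>As\<close>.\<close>

lemma kraw_tridiagonal_split_basis:
  assumes B: "linear_op B" and As: "linear_op As" and E: "eigenbasis d As E ths"
    and p: "p \<noteq> 0" and root: "\<forall>l\<in>{1..d}. p ^ l \<noteq> 1"
    and K: "kraw_split d p \<delta> m n \<delta>s ms th ths ph"
    and tri: "kraw_tridiagonal d p \<delta> m n B E"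
  obtains v where "split_basis d B As th ths ph v"
proof -
  note Eb = eigenbasisD(1)[OF E]
  obtain v where v: "ordered_basis scale d v"
    and Ev: "\<And>j. j \<le> d \<Longrightarrow> E j = comb d v (\<lambda>i. kraw_coeff d p m i j)"
  proof (rule exists_basis_with_unitriangular_change[OF Eb, where c = "kraw_coeff d p m"])
    show "kraw_coeff d p m j j = 1" for j
      by (rule kraw_coeff_diag)
    show "kraw_coeff d p m i j = 0" if "j < i" for i j
      using that by (rule kraw_coeff_upper)
  qed (rule that)
  obtain L where L: "linear_op L"
    "\<And>j. j \<le> d \<Longrightarrow> L (v j) = th j *s v j + (if j < d then v (j + 1) else 0)"
    by (rule exists_linear_op_on_basis[OF v,
          of "\<lambda>j. th j *s v j + (if j < d then v (j + 1) else 0)"]) (rule that)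
  obtain U where U: "linear_op U"
    "\<And>j. j \<le> d \<Longrightarrow> U (v j) = ths j *s v j + (if j = 0 then 0 else ph j *s v (j - 1))"
    by (rule exists_linear_op_on_basis[OF v,
          of "\<lambda>j. ths j *s v j + (if j = 0 then 0 else ph j *s v (j - 1))"]) (rule that)
  have LU: "split_basis d L U th ths ph v"
    unfolding split_basis_def
  proof (intro conjI v)
    show "is_lower_bidiagonal d th (matrix_wrt scale d v L)"
      by (rule is_lower_bidiagonalI[OF v]) (rule L(2))
    show "is_upper_bidiagonal d ths ph (matrix_wrt scale d v U)"
      by (rule is_upper_bidiagonalI[OF v]) (rule U(2))
  qed
  note model = split_basis_kraw_tridiagonal[OF L(1) U(1) LU p root K]
  have "L = B"
  proof (rule linear_op_eqI[OF Eb L(1) B])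
    fix j assume j: "j \<le> d"
    define F where "F j = comb d v (\<lambda>i. kraw_coeff d p m i j)" for j
    have FE: "F j = E j" if "j \<le> d" for j
      using Ev[OF that] by (simp add: F_def)
    have "kraw_tridiagonal d p \<delta> m n L F"
      using model(2) unfolding F_def .
    then have "L (F j) = (if j = d then 0 else F (Suc j)) + kraw_diag d p \<delta> m n j *s F j +
        (if j = 0 then 0 else kraw_prod d p (m * n) j *s F (j - 1))"
      using j by (simp add: kraw_tridiagonal_def)
    moreover have "(if j = d then 0 else F (Suc j)) = (if j = d then 0 else E (Suc j))"
      using FE[of "Suc j"] j by simp
    moreover have "F (j - 1) = E (j - 1)"
      using j by (intro FE) simp
    moreover have "B (E j) = (if j = d then 0 else E (Suc j)) + kraw_diag d p \<delta> m n j *s E j +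
        (if j = 0 then 0 else kraw_prod d p (m * n) j *s E (j - 1))"
      using tri j by (simp add: kraw_tridiagonal_def)
    ultimately show "L (E j) = B (E j)"
      by (simp only: FE[OF j])
  qed
  moreover have "U = As"
  proof (rule linear_op_eqI[OF Eb U(1) As])
    fix j assume j: "j \<le> d"
    have "U (comb d v (\<lambda>i. kraw_coeff d p m i j)) = ths j *s comb d v (\<lambda>i. kraw_coeff d p m i j)"
      by (rule eigenbasisD(2)[OF model(1) j])
    then show "U (E j) = As (E j)"
      by (simp only: Ev[OF j, symmetric] eigenbasisD(2)[OF E j])
  qed
  ultimately show thesis
    using LU that by blast
qed

end

section \<open>Powers of \<open>p\<close> and distinct eigenvalues\<close>

lemma kraw_factor_nonzero:
  fixes p :: "'a::field"
  assumes "\<forall>l\<in>{1..d}. p ^ l \<noteq> 1" "m \<noteq> 0" "i \<in> {1..d}"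
  shows "kraw_factor d p m i \<noteq> 0"
proof -
  have "d + 1 - i \<in> {1..d}"
    using assms(3) by auto
  with assms have "p ^ (d + 1 - i) \<noteq> 1" "p ^ i \<noteq> 1"
    by blast+
  with assms(2) show ?thesis
    by (simp add: kraw_factor_def)
qed

lemma root_free_inj:
  fixes p :: "'a::field"
  assumes p: "p \<noteq> 0" and root: "\<forall>l\<in>{1..d}. p ^ l \<noteq> 1"
    and ij: "i \<le> d" "j \<le> d" "p ^ i = p ^ j"
  shows "i = j"
proof -
  have aux: False if "a < b" "b \<le> d" "p ^ a = p ^ b" for a b
  proof -
    have "p ^ b = p ^ a * p ^ (b - a)"
      using that(1) by (simp flip: power_add)
    then have "p ^ a * p ^ (b - a) = p ^ a * 1"
      using that(3) by simp
    then have "p ^ (b - a) = 1"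
      using p by (simp only: mult_cancel_left) simp
    moreover have "b - a \<in> {1..d}"
      using that by auto
    ultimately show False
      using root by blast
  qed
  show ?thesis
    using aux[of i j] aux[of j i] ij by (cases i j rule: linorder_cases) auto
qed

text \<open>For \<open>n = - (m * p ^ d)\<close> the difference \<open>t i - t j\<close> is, up to a
  power of \<open>p\<close>, the product \<open>m * (p ^ i - p ^ j) * (p ^ (i + j) + p ^ d)\<close>.
  A collision thus means \<open>p ^ k = - 1\<close> for the distance \<open>k\<close> between
  \<open>i + j\<close> and \<open>d\<close>; distance 0 is excluded by \<open>2 \<noteq> 0\<close>,
  and \<open>i \<noteq> j\<close> bounds \<open>k\<close> by \<open>d - 1\<close>.\<close>

lemma contracted_eigenvalues_inj_iff:
  fixes p :: "'a::field"
  assumes two: "(2::'a) \<noteq> 0" and p: "p \<noteq> 0" and root: "\<forall>l\<in>{1..d}. p ^ l \<noteq> 1"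
    and m: "m \<noteq> 0" and n: "n + m * p ^ d = 0"
    and t: "\<forall>i\<le>d. t i = m * p ^ i + n / p ^ i"
  shows "inj_on t {..d} \<longleftrightarrow> (\<forall>k\<in>{1..d - 1}. p ^ k \<noteq> - 1)"
proof -
  have diff: "(t i - t j) * p ^ (i + j) = m * (p ^ i - p ^ j) * (p ^ (i + j) + p ^ d)"
    if "i \<le> d" "j \<le> d" for i j
  proof -
    have n': "n = - (m * p ^ d)"
      using n by (simp add: eq_neg_iff_add_eq_0)
    have tij: "t i = m * p ^ i + n / p ^ i" "t j = m * p ^ j + n / p ^ j"
      using t that by blast+
    have "(t i - t j) * p ^ (i + j) = m * (p ^ i - p ^ j) * p ^ (i + j) + n * (p ^ j - p ^ i)"
      unfolding tij using p by (simp add: power_add field_simps)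
    then show ?thesis
      by (simp add: n' algebra_simps)
  qed
  have eq_iff: "t i = t j \<longleftrightarrow> p ^ (i + j) = - (p ^ d)" if "i \<le> d" "j \<le> d" "i \<noteq> j" for i j
  proof -
    have "p ^ i \<noteq> p ^ j"
      using root_free_inj[OF p root] that by blast
    then have "(t i - t j) * p ^ (i + j) = 0 \<longleftrightarrow> p ^ (i + j) + p ^ d = 0"
      unfolding diff[OF that(1,2)] using m by simp
    then show ?thesis
      using p by (simp add: eq_neg_iff_add_eq_0)
  qed
  have one: "p ^ k = - 1" if "p ^ a * p ^ k = - (p ^ a)" for a k
  proof -
    have "p ^ a * p ^ k = p ^ a * (- 1)"
      using that by simp
    then show ?thesis
      using p by (simp only: mult_cancel_left) simp
  qed
  have split: "p ^ b = p ^ a * p ^ (b - a)" if "a \<le> b" for a b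
    using that by (simp flip: power_add)
  show ?thesis
  proof
    assume inj: "inj_on t {..d}"
    show "\<forall>k\<in>{1..d - 1}. p ^ k \<noteq> - 1"
    proof (intro ballI notI)
      fix k assume k: "k \<in> {1..d - 1}" "p ^ k = - 1"
      \<comment> \<open>The colliding indices are \<open>d - k\<close> and \<open>0\<close>.\<close>
      have dk: "d - k \<le> d" "d - k \<noteq> 0" "d - (d - k) = k"
        using k(1) by auto
      have "p ^ d = - (p ^ (d - k))"
        using split[OF dk(1)] unfolding dk(3) k(2) by (simp only: mult_minus1_right)
      then have "p ^ (d - k + 0) = - (p ^ d)"
        by (simp only: add_0_right minus_minus)
      then have "t (d - k) = t 0"
        using eq_iff[OF dk(1) le0 dk(2)] by blast
      then have "d - k = 0"
        by (rule inj_onD[OF inj]) auto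
      then show False
        using k(1) by auto
    qed
  next
    assume re: "\<forall>k\<in>{1..d - 1}. p ^ k \<noteq> - 1"
    show "inj_on t {..d}"
    proof (rule inj_onI, rule ccontr)
      fix i j assume ij: "i \<in> {..d}" "j \<in> {..d}" "t i = t j" "i \<noteq> j"
      then have e: "p ^ (i + j) = - (p ^ d)"
        using eq_iff[of i j] by simp
      consider "i + j = d" | "i + j < d" | "d < i + j"
        by linarith
      then show False
      proof cases
        case 1
        have "2 * p ^ d = 0"
          using e unfolding 1 eq_neg_iff_add_eq_0 mult_2 .
        then show False
          using two p by simp
      next
        case 2
        have "p ^ d = p ^ (i + j) * p ^ (d - (i + j))"
          using 2 by (intro split) simp
        with e have "p ^ (i + j) * p ^ (d - (i + j)) = - (p ^ (i + j))"
          by (metis minus_minus)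
        then have "p ^ (d - (i + j)) = - 1"
          by (rule one)
        moreover have "d - (i + j) \<in> {1..d - 1}"
          using 2 ij(4) by auto
        ultimately show False
          using re by blast
      next
        case 3
        have "p ^ (i + j) = p ^ d * p ^ (i + j - d)"
          using 3 by (intro split) simp
        with e have "p ^ d * p ^ (i + j - d) = - (p ^ d)"
          by metis
        then have "p ^ (i + j - d) = - 1"
          by (rule one)
        moreover have "i + j - d \<in> {1..d - 1}"
          using 3 ij by auto
        ultimately show False
          using re by blast
      qed
    qed
  qed
qed

section \<open>The contraction in split form\<close>

context coordinate_space
begin

lemma leonard_pairD:
  assumes "leonard_pair scale d A As"
  shows "linear_op A" "linear_op As" "dim (UNIV :: 'b set) = d + 1"
  using assms by (simp_all add: leonard_pair_def)

lemma leonard_pairI: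
  assumes "dim (UNIV :: 'b set) = d + 1" "linear_op A" "linear_op As"
    and "standard_ordering scale d A As th" "standard_ordering scale d As A ths"
  shows "leonard_pair scale d A As"
  using assms unfolding leonard_pair_def standard_ordering_def diagonal_def is_diag_def by metis

lemma leonard_pair_eigenbasis:
  assumes "leonard_pair scale d A As"
  obtains w u where "eigenbasis d A w u"
proof -
  obtain w where w: "ordered_basis scale d w" "diagonal d (matrix_wrt scale d w A)"
    using assms by (auto simp: leonard_pair_def)
  then have "is_diag d (\<lambda>i. matrix_wrt scale d w A i i) (matrix_wrt scale d w A)"
    by (simp add: is_diag_def diagonal_def)
  with w(1) that show thesis
    by (auto simp: eigenbasis_def is_diag_iff)
qed

text \<open>Reversal exchanges the powers \<open>p ^ i\<close> and \<open>1 / p ^ i\<close>. The new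
  parameters \<open>n / p ^ d\<close> and \<open>m * p ^ d\<close> have the same product and the
  same value of \<open>n + m * p ^ d\<close>, hence describe the same tridiagonal form.\<close>

lemma kraw_split_reverse:
  assumes K: "kraw_split d p \<delta> m n \<delta>s ms th ths ph" and p: "p \<noteq> 0"
    and ph': "\<forall>i\<in>{1..d}. ph' i = ms * p ^ (i - 1) * kraw_factor d p (n / p ^ d) i"
  shows "kraw_split d p \<delta> (n / p ^ d) (m * p ^ d) \<delta>s ms (\<lambda>i. th (d - i)) ths ph'"
proof -
  have "th (d - i) = \<delta> + n / p ^ d * p ^ i + m * p ^ d / p ^ i" if "i \<le> d" for i
  proof -
    have "p ^ d = p ^ (d - i) * p ^ i"
      using that by (simp add: power_add[symmetric])
    then show ?thesis
      using K p by (simp add: kraw_split_def)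
  qed
  with K ph' show ?thesis
    by (simp add: kraw_split_def)
qed

lemma contraction_kraw_tridiagonal:
  assumes A: "linear_op A" and As: "linear_op As" and E: "eigenbasis d As E ths"
    and inj: "inj_on ths {..d}" and tri: "kraw_tridiagonal d p \<delta> m n A E"
    and n': "n' + m' * p ^ d = 0" "m' * n' = m * n"
  shows "linear_op (contraction scale A As)"
    "kraw_tridiagonal d p 0 m' n' (contraction scale A As) E"
proof -
  note Eb = eigenbasisD(1)[OF E]
  have F: "linear_op (flat_part scale A As)"
    by (rule linear_flat_part[OF A As E inj])
  show "linear_op (contraction scale A As)"
    using A F by (simp add: linear_op_iff contraction_def scale_right_diff_distrib)
  show "kraw_tridiagonal d p 0 m' n' (contraction scale A As) E"
    unfolding kraw_tridiagonal_def
  proof (intro allI impI)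
    fix j assume j: "j \<le> d"
    have AE: "A (E j) = (if j = d then 0 else E (Suc j)) + kraw_diag d p \<delta> m n j *s E j +
        (if j = 0 then 0 else kraw_prod d p (m * n) j *s E (j - 1))"
      using tri j by (simp add: kraw_tridiagonal_def)
    have "matrix_wrt scale d E A j j = kraw_diag d p \<delta> m n j"
      unfolding matrix_wrt_eq_coord AE using j
      by (auto simp: coord_add[OF Eb] coord_scale[OF Eb] coord_basis[OF Eb] coord_zero)
    then have "contraction scale A As (E j) = A (E j) - kraw_diag d p \<delta> m n j *s E j"
      using flat_part_eigenvector[OF A As E inj j] by (simp add: contraction_def)
    moreover have "kraw_diag d p 0 m' n' j = 0"
      using n'(1) by (simp add: kraw_diag_def)
    ultimately show "contraction scale A As (E j) = (if j = d then 0 else E (Suc j)) +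
        kraw_diag d p 0 m' n' j *s E j + (if j = 0 then 0 else kraw_prod d p (m' * n') j *s E (j - 1))"
      using AE by (simp add: n'(2))
  qed
qed

lemma kraw_tridiagonal_irreducible:
  assumes E: "ordered_basis scale d E" and tri: "kraw_tridiagonal d p \<delta> m n B E"
    and p: "p \<noteq> 0" and root: "\<forall>l\<in>{1..d}. p ^ l \<noteq> 1" and "m * n \<noteq> 0"
  shows "irreducible_tridiagonal d (matrix_wrt scale d E B)"
proof -
  have M: "matrix_wrt scale d E B i j = (if i = Suc j then 1 else 0) +
      kraw_diag d p \<delta> m n j * (if i = j then 1 else 0) +
      (if j = Suc i then kraw_prod d p (m * n) j else 0)" if "i \<le> d" "j \<le> d" for i j
  proof -
    have BE: "B (E j) = (if j = d then 0 else E (Suc j)) + kraw_diag d p \<delta> m n j *s E j +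
        (if j = 0 then 0 else kraw_prod d p (m * n) j *s E (j - 1))"
      using tri that by (simp add: kraw_tridiagonal_def)
    show ?thesis
      unfolding matrix_wrt_eq_coord BE using that
      by (auto simp: coord_add[OF E] coord_scale[OF E] coord_basis[OF E] coord_zero)
  qed
  have "kraw_prod d p (m * n) (Suc i) \<noteq> 0" if "i < d" for i
  proof -
    have "kraw_factor d p (m * n) (Suc i) \<noteq> 0"
      using that by (intro kraw_factor_nonzero root assms(5)) auto
    then show ?thesis
      using p by (simp add: kraw_prod_def kraw_factor_def)
  qed
  then show ?thesis
    unfolding irreducible_tridiagonal_def by (auto simp: M)
qed

theorem krawtchouk_contraction:
  assumes two: "(2::'a) \<noteq> 0" and lp: "leonard_pair scale d A As"
    and std: "standard_ordering scale d As A ths"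
    and v: "split_basis d A As th ths ph v"
    and p: "p \<noteq> 0" and root: "\<forall>l\<in>{1..d}. p ^ l \<noteq> 1"
    and K: "kraw_split d p \<delta> m n \<delta>s ms th ths ph" and mn: "m * n \<noteq> 0" "ms \<noteq> 0"
    and n': "n' + m' * p ^ d = 0" "m' * n' = m * n"
    and K': "kraw_split d p 0 m' n' \<delta>s ms th' ths vphi'"
    and phi': "\<forall>i\<in>{1..d}. phi' i = ms * p ^ (i - 1) * kraw_factor d p (n' / p ^ d) i"
  shows "near_bipartite scale d A As \<longleftrightarrow> (\<forall>k\<in>{1..d - 1}. p ^ k \<noteq> - 1)"
    and "near_bipartite scale d A As \<Longrightarrow>
      parameter_array scale d (contraction scale A As) As th' ths vphi' phi'"
proof -
  let ?B = "contraction scale A As"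
  note A = leonard_pairD(1)[OF lp] and As = leonard_pairD(2)[OF lp]
  have inj: "inj_on ths {..d}"
    using std by (rule standard_orderingE)
  define E where "E = (\<lambda>j. comb d v (\<lambda>i. kraw_coeff d p m i j))"
  have E: "eigenbasis d As E ths" and tri: "kraw_tridiagonal d p \<delta> m n A E"
    unfolding E_def by (rule split_basis_kraw_tridiagonal[OF A As v p root K])+
  note B = contraction_kraw_tridiagonal(1)[OF A As E inj tri n']
    and triB = contraction_kraw_tridiagonal(2)[OF A As E inj tri n']
  have K'': "kraw_split d p 0 (n' / p ^ d) (m' * p ^ d) \<delta>s ms (\<lambda>i. th' (d - i)) ths phi'"
    by (rule kraw_split_reverse[OF K' p phi'])
  have "kraw_tridiagonal d p 0 (n' / p ^ d) (m' * p ^ d) ?B E"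
    using triB p by (simp add: kraw_tridiagonal_def kraw_diag_def mult.commute add.commute)
  from kraw_tridiagonal_split_basis[OF B As E p root K'' this]
  obtain v2 where v2: "split_basis d ?B As (\<lambda>i. th' (d - i)) ths phi' v2"
    by blast
  from kraw_tridiagonal_split_basis[OF B As E p root K' triB]
  obtain v1 where v1: "split_basis d ?B As th' ths vphi' v1"
    by blast
  have m': "m' \<noteq> 0" "n' / p ^ d \<noteq> 0"
    using n'(2) mn p by auto
  have inj_iff: "inj_on th' {..d} \<longleftrightarrow> (\<forall>k\<in>{1..d - 1}. p ^ k \<noteq> - 1)"
    using K' by (intro contracted_eigenvalues_inj_iff[OF two p root m'(1) n'(1)])
      (simp add: kraw_split_def)
  have pa: "parameter_array scale d ?B As th' ths vphi' phi'" if "inj_on th' {..d}"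
  proof -
    have nz: "vphi' i \<noteq> 0" "phi' i \<noteq> 0" if "i \<in> {1..d}" for i
      using K' phi' that p mn kraw_factor_nonzero[OF root m'(1) that] kraw_factor_nonzero[OF root m'(2) that]
      by (auto simp: kraw_split_def)
    have s1: "standard_ordering scale d ?B As th'"
      by (rule standard_ordering_of_split_bases[OF B As that v1 nz(1) v2 nz(2)])
    have "irreducible_tridiagonal d (matrix_wrt scale d E ?B)"
      using n'(2) mn
      by (intro kraw_tridiagonal_irreducible[OF eigenbasisD(1)[OF E] triB p root]) simp
    then have s2: "standard_ordering scale d As ?B ths"
      by (rule standard_orderingI[OF As E inj])
    show ?thesis
      unfolding parameter_array_def
      using leonard_pairI[OF leonard_pairD(3)[OF lp] B As s1 s2] s1 s2 v1 v2
      unfolding split_basis_def by blast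
  qed
  have inj': "inj_on th' {..d}" if nb: "near_bipartite scale d A As"
  proof -
    \<comment> \<open>Members of a Leonard pair are diagonalizable; for the contraction, lower
      bidiagonal in \<open>v1\<close>, this excludes repetitions among the
      \<open>th' i\<close>.\<close>
    obtain w u where "eigenbasis d ?B w u"
      using nb by (auto simp: near_bipartite_def elim: leonard_pair_eigenbasis)
    then show ?thesis
      by (rule lower_bidiagonal_diagonalizable_inj[OF B split_basisD(1,2)[OF v1]])
  qed
  show "near_bipartite scale d A As \<longleftrightarrow> (\<forall>k\<in>{1..d - 1}. p ^ k \<noteq> - 1)"
    using inj' inj_iff pa lp by (auto simp: near_bipartite_def parameter_array_def)
  show "parameter_array scale d ?B As th' ths vphi' phi'" if "near_bipartite scale d A As"
    using pa inj' that by blast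
qed


section \<open>End entries of a parameter array\<close>

lemma parameter_arrayD:
  assumes "parameter_array scale d A As th ths vphi phi"
  shows "leonard_pair scale d A As" "standard_ordering scale d A As th"
    "standard_ordering scale d As A ths" "\<exists>v. split_basis d A As th ths vphi v"
    "\<exists>v. split_basis d A As (\<lambda>i. th (d - i)) ths phi v"
  using assms by (simp_all add: parameter_array_def split_basis_def)

text \<open>These values later force \<open>\<mu>\<close> and \<open>h\<close> to be nonzero. The
  second split basis starts with the eigenvalue \<open>th d\<close>, hence the index
  \<open>d\<close> in its case.\<close>

lemma parameter_array_first_nonzero:
  assumes pa: "parameter_array scale d A As th ths vphi phi" and "0 < d"
  shows "vphi 1 \<noteq> 0" "phi 1 \<noteq> 0"
proof -
  note A = leonard_pairD(1)[OF parameter_arrayD(1)[OF pa]]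
    and As = leonard_pairD(2)[OF parameter_arrayD(1)[OF pa]]
  obtain w where w: "eigenbasis d A w th" "irreducible_tridiagonal d (matrix_wrt scale d w As)"
    "inj_on th {..d}"
    using parameter_arrayD(2)[OF pa] by (rule standard_orderingE)
  obtain v where v: "split_basis d A As th ths vphi v"
    using parameter_arrayD(4)[OF pa] by blast
  obtain u where u: "split_basis d A As (\<lambda>i. th (d - i)) ths phi u"
    using parameter_arrayD(5)[OF pa] by blast
  show "vphi 1 \<noteq> 0"
    by (rule split_sequence_first_nonzero[OF A As \<open>0 < d\<close> w(1,3,2) v, of 0]) simp_all
  show "phi 1 \<noteq> 0"
    by (rule split_sequence_first_nonzero[OF A As \<open>0 < d\<close> w(1,3,2) u, of d]) simp_all
qed

text \<open>Diagonal entries of \<open>A\<close> do not change when eigenvectors of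
  \<open>As\<close> are rescaled, so both split bases refer to the same numbers \<open>a 0\<close>
  and \<open>a d\<close>.\<close>

lemma parameter_array_end_entries:
  assumes pa: "parameter_array scale d A As th ths vphi phi" and "0 < d"
    and E: "eigenbasis d As E ths"
  defines "a \<equiv> \<lambda>i. matrix_wrt scale d E A i i"
  shows "vphi 1 = (a 0 - th 0) * (ths 0 - ths 1)" "vphi d = (a d - th d) * (ths d - ths (d - 1))"
    "phi 1 = (a 0 - th d) * (ths 0 - ths 1)" "phi d = (a d - th 0) * (ths d - ths (d - 1))"
proof -
  note A = leonard_pairD(1)[OF parameter_arrayD(1)[OF pa]]
    and As = leonard_pairD(2)[OF parameter_arrayD(1)[OF pa]]
  have inj: "inj_on ths {..d}"
    using parameter_arrayD(3)[OF pa] by (rule standard_orderingE)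
  obtain v where v: "split_basis d A As th ths vphi v"
    using parameter_arrayD(4)[OF pa] by blast
  obtain u where u: "split_basis d A As (\<lambda>i. th (d - i)) ths phi u"
    using parameter_arrayD(5)[OF pa] by blast
  have indep: "matrix_wrt scale d G A i i = a i" if "eigenbasis d As G ths" "i \<le> d" for G i
    unfolding a_def by (rule diagonal_entry_eq[OF A As that(1) inj E inj that(2) that(2) refl])
  obtain G where "eigenbasis d As G ths"
    "vphi 1 = (matrix_wrt scale d G A 0 0 - th 0) * (ths 0 - ths 1)"
    "vphi d = (matrix_wrt scale d G A d d - th d) * (ths d - ths (d - 1))"
    by (rule split_basis_end_entries[OF A As \<open>0 < d\<close> inj v])
  then show "vphi 1 = (a 0 - th 0) * (ths 0 - ths 1)"
      "vphi d = (a d - th d) * (ths d - ths (d - 1))"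
    by (simp_all add: indep)
  obtain H where "eigenbasis d As H ths"
    "phi 1 = (matrix_wrt scale d H A 0 0 - th (d - 0)) * (ths 0 - ths 1)"
    "phi d = (matrix_wrt scale d H A d d - th (d - d)) * (ths d - ths (d - 1))"
    by (rule split_basis_end_entries[OF A As \<open>0 < d\<close> inj u])
  then show "phi 1 = (a 0 - th d) * (ths 0 - ths 1)"
      "phi d = (a d - th 0) * (ths d - ths (d - 1))"
    by (simp_all add: indep)
qed

text \<open>Equality of the ratios at the two ends is a condition that no longer refers to the
  split sequences and is invariant under reversal of either standard ordering; so it
  carries over to every parameter array of the pair.\<close>

lemma constant_ratio_end_entries:
  assumes pa: "parameter_array scale d A As th ths vphi phi" and "0 < d"
    and c: "\<forall>i\<in>{1..d}. vphi i / phi i = c" and E: "eigenbasis d As E ths"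
  shows "matrix_wrt scale d E A 0 0 + matrix_wrt scale d E A d d = th 0 + th d"
proof -
  note ends = parameter_array_end_entries[OF pa \<open>0 < d\<close> E]
  note nz = parameter_array_first_nonzero[OF pa \<open>0 < d\<close>]
  let ?a = "matrix_wrt scale d E A 0 0" and ?b = "matrix_wrt scale d E A d d"
  have inj: "inj_on ths {..d}"
    using parameter_arrayD(3)[OF pa] by (rule standard_orderingE)
  have injt: "inj_on th {..d}"
    using parameter_arrayD(2)[OF pa] by (rule standard_orderingE)
  have D: "ths 0 - ths 1 \<noteq> 0" "ths d - ths (d - 1) \<noteq> 0" "th d - th 0 \<noteq> 0"
    using \<open>0 < d\<close> inj_onD[OF inj, of 0 1] inj_onD[OF inj, of d "d - 1"] inj_onD[OF injt, of d 0]
    by auto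
  have c1: "vphi 1 / phi 1 = c" and cd: "vphi d / phi d = c"
    using \<open>0 < d\<close> by (auto intro!: bspec[OF c])
  \<comment> \<open>As division by zero gives 0, \<open>phi d = 0\<close> would make the constant
    ratio 0, whereas \<open>vphi 1 / phi 1\<close> is nonzero.\<close>
  have "phi d \<noteq> 0"
  proof
    assume "phi d = 0"
    then have "vphi 1 / phi 1 = 0"
      unfolding c1 cd[symmetric] by simp
    then show False
      using nz by simp
  qed
  then have "vphi 1 * phi d = vphi d * phi 1"
    using nz(2) frac_eq_eq[of "phi 1" "phi d" "vphi 1" "vphi d"] c1 cd by simp
  then have "((?a - th 0) * (?b - th 0) - (?b - th d) * (?a - th d)) *
      ((ths 0 - ths 1) * (ths d - ths (d - 1))) = 0"
    unfolding ends left_diff_distrib[of _ _ "_ * _"] right_minus_eq by (simp only: mult_ac)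
  then have "(?a - th 0) * (?b - th 0) - (?b - th d) * (?a - th d) = 0"
    using D(1,2) by (simp only: mult_eq_0_iff) simp
  \<comment> \<open>Once \<open>th d - th 0\<close> is split off, the equation of the end ratios is
    linear in \<open>?a + ?b\<close>.\<close>
  moreover have "(th d - th 0) * (?a + ?b - (th 0 + th d)) =
      (?a - th 0) * (?b - th 0) - (?b - th d) * (?a - th d)"
    by (simp add: algebra_simps)
  ultimately have "(th d - th 0) * (?a + ?b - (th 0 + th d)) = 0"
    by (simp only:)
  then have "?a + ?b - (th 0 + th d) = 0"
    using D(3) by (simp only: mult_eq_0_iff) simp
  then show ?thesis
    by (simp only: right_minus_eq)
qed

text \<open>The type speaks about some parameter array, the conclusions about the given one.
  Standard orderings agree up to reversal, and what is transported is symmetric under it: the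
  progression condition and the sum of the end diagonal entries of \<open>A\<close>.\<close>

lemma dual_q_krawtchouk_type_facts:
  assumes dual: "dual_q_krawtchouk_type scale d q A As" and d: "3 \<le> d"
    and pa: "parameter_array scale d A As th ths vphi phi"
  shows "(ths 0 - ths 1) * (ths 2 - ths 3) = (ths 1 - ths 2) ^ 2" (is ?geom)
    and "vphi 1 * (ths (d - 1) - ths d) = vphi d * (ths 0 - ths 1)" (is ?ends)
    and "q \<noteq> 0"
proof -
  obtain t ts vp ph c c' where pa0: "parameter_array scale d A As t ts vp ph"
    and c: "\<forall>i\<in>{1..d - 1}. (ts (i - 1) - ts i) / (ts i - ts (i + 1)) = c"
    and c': "\<forall>i\<in>{1..d}. vp i / ph i = c'"
    using dual unfolding dual_q_krawtchouk_type_def by blast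
  note A = leonard_pairD(1)[OF parameter_arrayD(1)[OF pa]]
    and As = leonard_pairD(2)[OF parameter_arrayD(1)[OF pa]]
  have t: "(\<forall>i\<le>d. t i = th i) \<or> (\<forall>i\<le>d. t i = th (d - i))"
    by (rule standard_ordering_unique[OF A As parameter_arrayD(2)[OF pa] parameter_arrayD(2)[OF pa0]])
  have ts: "(\<forall>i\<le>d. ts i = ths i) \<or> (\<forall>i\<le>d. ts i = ths (d - i))"
    by (rule standard_ordering_unique[OF As A parameter_arrayD(3)[OF pa] parameter_arrayD(3)[OF pa0]])
  obtain E where E: "eigenbasis d As E ths" and inj: "inj_on ths {..d}"
    using parameter_arrayD(3)[OF pa] by (rule standard_orderingE)
  obtain G where G: "eigenbasis d As G ts" and injG: "inj_on ts {..d}"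
    using parameter_arrayD(3)[OF pa0] by (rule standard_orderingE)
  have nz: "ts i - ts (i + 1) \<noteq> 0" if "i < d" for i
    using inj_onD[OF injG, of i "i + 1"] that by auto
  have geom: "(ts (i - 1) - ts i) * (ts (i + 1) - ts (i + 2)) = (ts i - ts (i + 1)) ^ 2"
    if "i \<in> {1..d - 2}" for i
  proof -
    have "(ts (i - 1) - ts i) / (ts i - ts (i + 1)) =
        (ts (i + 1 - 1) - ts (i + 1)) / (ts (i + 1) - ts (i + 1 + 1))"
      using bspec[OF c, of i] bspec[OF c, of "i + 1"] that d by fastforce
    moreover have "ts i - ts (i + 1) \<noteq> 0" "ts (i + 1) - ts (i + 1 + 1) \<noteq> 0"
      using that d by (intro nz; auto)+
    ultimately show ?thesis
      by (simp add: frac_eq_eq power2_eq_square)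
  qed
  show ?geom
    using ts
  proof
    assume "\<forall>i\<le>d. ts i = ths i"
    then show ?thesis
      using geom[of 1] d by (simp add: numeral_eq_Suc)
  next
    \<comment> \<open>Under reversal the first three differences of \<open>ths\<close> are the last
      three of \<open>ts\<close>, hence the index \<open>d - 2\<close>.\<close>
    assume r: "\<forall>i\<le>d. ts i = ths (d - i)"
    have "ts (d - 2 - 1) = ths 3" "ts (d - 2) = ths 2" "ts (d - 2 + 1) = ths 1"
      "ts (d - 2 + 2) = ths 0"
      using r d by (auto simp: Suc_diff_le numeral_eq_Suc)
    then show ?thesis
      using geom[of "d - 2"] d by (simp add: algebra_simps power2_eq_square)
  qed
  let ?a = "\<lambda>i. matrix_wrt scale d E A i i" and ?g = "\<lambda>i. matrix_wrt scale d G A i i"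
  have "?g 0 + ?g d = t 0 + t d"
    using constant_ratio_end_entries[OF pa0 _ c' G] d by simp
  moreover have "t 0 + t d = th 0 + th d"
    using t by (auto simp: add.commute)
  moreover have "?g 0 + ?g d = ?a 0 + ?a d"
    using ts
  proof
    assume r: "\<forall>i\<le>d. ts i = ths i"
    have "?g i = ?a i" if "i \<le> d" for i
      by (rule diagonal_entry_eq[OF A As G injG E inj that that]) (use r that in simp)
    then show ?thesis by simp
  next
    assume r: "\<forall>i\<le>d. ts i = ths (d - i)"
    have "?g i = ?a (d - i)" if "i \<le> d" for i
      by (rule diagonal_entry_eq[OF A As G injG E inj that diff_le_self]) (use r that in simp)
    from this[of 0] this[of d] show ?thesis by simp
  qed
  ultimately have opp: "?a 0 - th 0 = - (?a d - th d)"
    by (simp add: algebra_simps)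
  have "0 < d"
    using d by simp
  show ?ends
    unfolding parameter_array_end_entries(1,2)[OF pa \<open>0 < d\<close> E] opp
    by (simp add: algebra_simps)
  show "q \<noteq> 0"
    using dual by (simp add: dual_q_krawtchouk_type_def)
qed

end

section \<open>Dual $q$-Krawtchouk type\<close>

lemma powi_convert:
  fixes q :: "'a::field"
  assumes q: "q \<noteq> 0"
  shows "q powi (2 * int i - int d) = (q ^ 2) ^ i / q ^ d"
    and "q powi (int d - 2 * int i) = q ^ d / (q ^ 2) ^ i"
    and "q powi (2 * int i - int d - 1) = (q ^ 2) ^ i / (q ^ d * q)"
proof -
  have *: "q powi (2 * int i) = (q ^ 2) ^ i"
    by (metis of_nat_mult of_nat_numeral power_int_of_nat power_mult)
  show "q powi (2 * int i - int d) = (q ^ 2) ^ i / q ^ d"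
    "q powi (int d - 2 * int i) = q ^ d / (q ^ 2) ^ i"
    "q powi (2 * int i - int d - 1) = (q ^ 2) ^ i / (q ^ d * q)"
    using q by (simp_all add: power_int_diff *)
qed

lemma split_factor_convert:
  fixes q :: "'a::field"
  assumes q: "q \<noteq> 0" and i: "i \<le> d"
  shows "split_factor d q i = ((q ^ 2) ^ i - 1) * ((q ^ 2) ^ (d + 1 - i) - 1) / (q ^ d * q)"
proof -
  have sub: "q powi int k - q powi (- int k) = ((q ^ 2) ^ k - 1) / q ^ k" for k
  proof -
    have "(q ^ 2) ^ k = q ^ k * q ^ k"
      by (metis power2_eq_square power_mult_distrib)
    then show ?thesis
      using q by (simp add: power_int_minus field_simps)
  qed
  have "int d - int i + 1 = int (d + 1 - i)" "int i - int d - 1 = - int (d + 1 - i)"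
    using i by auto
  then have "split_factor d q i =
      ((q ^ 2) ^ i - 1) / q ^ i * (((q ^ 2) ^ (d + 1 - i) - 1) / q ^ (d + 1 - i))"
    unfolding split_factor_def by (simp only: sub)
  also have "\<dots> = ((q ^ 2) ^ i - 1) * ((q ^ 2) ^ (d + 1 - i) - 1) / (q ^ i * q ^ (d + 1 - i))"
    by simp
  also have "q ^ i * q ^ (d + 1 - i) = q ^ d * q"
    using i by (simp flip: power_add)
  finally show ?thesis .
qed

section \<open>The symmetry between \<open>q\<close> and \<open>inverse q\<close>\<close>

lemma inverse_powi: "inverse q powi n = (q::'a::field) powi (- n)"
  by (simp add: power_int_minus power_int_inverse)

lemma split_factor_inverse: "split_factor d (inverse q) i = split_factor d (q::'a::field) i"
  unfolding split_factor_def inverse_powi by (simp add: algebra_simps)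

lemma primary_q_data_inverse:
  assumes "primary_q_data d q th ths vphi phi \<delta> \<mu> h \<delta>s \<mu>s hs \<tau>"
  shows "primary_q_data d (inverse q) th ths vphi phi \<delta> h \<mu> \<delta>s hs \<mu>s \<tau>"
  using assms unfolding primary_q_data_def split_factor_inverse inverse_powi
  by (simp add: algebra_simps)

lemma dual_q_krawtchouk_type_inverse:
  "dual_q_krawtchouk_type scale d (inverse q) A As = dual_q_krawtchouk_type scale d q A As"
  unfolding dual_q_krawtchouk_type_def inverse_powi by (simp add: add.commute)

lemma power_inverse_eq_minus_one_iff: "inverse q ^ k = - 1 \<longleftrightarrow> (q::'a::field) ^ k = - 1"
  by (metis inverse_inverse_eq inverse_minus_eq inverse_1 power_inverse)

lemma reinforced_dual_q_krawtchouk_type_inverse: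
  "reinforced_dual_q_krawtchouk_type scale d (inverse q) A As =
    reinforced_dual_q_krawtchouk_type scale d q A As"
  unfolding reinforced_dual_q_krawtchouk_type_def
  by (simp only: dual_q_krawtchouk_type_inverse power_inverse_eq_minus_one_iff)

text \<open>Constants, \<open>p ^ i\<close> and \<open>1 / p ^ i\<close> all satisfy the linear
  relation \<open>x (i - 2) - x (i + 1) = (p + 1 / p + 1) * (x (i - 1) - x i)\<close>.\<close>

lemma three_term_quotient:
  fixes p :: "'a::field"
  assumes p: "p \<noteq> 0" and x: "\<And>i. i \<le> d \<Longrightarrow> x i = \<delta> + m * p ^ i + n / p ^ i"
    and i: "2 \<le> i" "i + 1 \<le> d" and ne: "x (i - 1) \<noteq> x i"
  shows "(x (i - 2) - x (i + 1)) / (x (i - 1) - x i) = p + 1 / p + 1"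
proof -
  obtain k where k: "i = k + 2"
    using i(1) by (metis add.commute le_Suc_ex)
  define P where "P = p ^ k"
  have P: "P \<noteq> 0"
    using p by (simp add: P_def)
  have eqs: "i - 2 = k" "i - 1 = k + 1" "i + 1 = k + 3"
    using k by auto
  have xs: "x k = \<delta> + m * P + n / P" "x (k + 1) = \<delta> + m * (P * p) + n / (P * p)"
    "x (k + 2) = \<delta> + m * (P * p ^ 2) + n / (P * p ^ 2)"
    "x (k + 3) = \<delta> + m * (P * p ^ 3) + n / (P * p ^ 3)"
    using x[of k] x[of "k + 1"] x[of "k + 2"] x[of "k + 3"] i k
    by (simp_all only: P_def power_add power_one_right)
  have "x (i - 2) - x (i + 1) = (p + 1 / p + 1) * (x (i - 1) - x i)"
    unfolding eqs unfolding k xs using p P by (simp add: field_simps power2_eq_square power3_eq_cube)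
  then show ?thesis
    using ne by (simp add: field_simps)
qed

text \<open>Differences of \<open>p ^ i\<close> have ratio \<open>p\<close>, those of
  \<open>1 / p ^ i\<close> have ratio \<open>1 / p\<close>, and a genuine mixture is not geometric:
  its defect is \<open>a * b\<close> times a factor that is nonzero under the hypotheses.\<close>

lemma geometric_pair_product:
  fixes p :: "'a::field"
  assumes p: "p \<noteq> 0" "p \<noteq> 1" "p ^ 2 \<noteq> 1"
    and x: "\<And>i. i \<le> 3 \<Longrightarrow> x i = \<delta> + a * p ^ i + b / p ^ i"
    and geom: "(x 0 - x 1) * (x 2 - x 3) = (x 1 - x 2) ^ 2"
  shows "a * b = 0"
proof -
  have xs: "x 0 = \<delta> + a + b" "x 1 = \<delta> + a * p + b / p" "x 2 = \<delta> + a * p ^ 2 + b / p ^ 2"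
    "x 3 = \<delta> + a * p ^ 3 + b / p ^ 3"
    using x[of 0] x[of 1] x[of 2] x[of 3] by simp_all
  have "((x 0 - x 1) * (x 2 - x 3) - (x 1 - x 2) ^ 2) * p ^ 3 =
      - ((1 - p) ^ 2 * (p ^ 2 - 1) ^ 2 * (a * b))"
    unfolding xs using p(1) by (simp add: field_simps power2_eq_square power3_eq_cube)
  then have "(1 - p) ^ 2 * (p ^ 2 - 1) ^ 2 * (a * b) = 0"
    by (simp only: geom) simp
  then show ?thesis
    using p by auto
qed

section \<open>The contraction in terms of primary $q$-data\<close>

context coordinate_space
begin

lemma dual_q_krawtchouk_typeI:
  assumes pa: "parameter_array scale d B As th ths vphi phi" and d: "3 \<le> d"
    and q: "q \<noteq> 0" and p: "p = q ^ 2" and root: "\<forall>l\<in>{1..d}. p ^ l \<noteq> 1"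
    and K: "kraw_split d p \<delta> m n \<delta>s ms th ths vphi" and mn: "m * n \<noteq> 0" "ms \<noteq> 0"
    and phi: "\<forall>i\<in>{1..d}. phi i = ms * p ^ (i - 1) * kraw_factor d p (n / p ^ d) i"
  shows "dual_q_krawtchouk_type scale d q B As"
proof -
  have p0: "p \<noteq> 0"
    using q p by simp
  have injt: "inj_on th {..d}"
    using parameter_arrayD(2)[OF pa] by (rule standard_orderingE)
  have injs: "inj_on ths {..d}"
    using parameter_arrayD(3)[OF pa] by (rule standard_orderingE)
  have \<beta>: "q powi 2 + q powi (- 2) = p + 1 / p"
    by (simp add: p power_int_minus inverse_eq_divide)
  have th: "th i = \<delta> + m * p ^ i + n / p ^ i" if "i \<le> d" for i
    using K that by (simp add: kraw_split_def)
  have ths: "ths i = \<delta>s + ms * p ^ i" if "i \<le> d" for i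
    using K that by (simp add: kraw_split_def)
  have ths0: "ths i = \<delta>s + ms * p ^ i + 0 / p ^ i" if "i \<le> d" for i
    using ths[OF that] by simp
  have quot: "(th (i - 2) - th (i + 1)) / (th (i - 1) - th i) = p + 1 / p + 1"
    "(ths (i - 2) - ths (i + 1)) / (ths (i - 1) - ths i) = p + 1 / p + 1"
    if "i \<in> {2..d - 1}" for i
  proof -
    have i: "2 \<le> i" "i + 1 \<le> d"
      using that d by auto
    have "i - 1 \<noteq> i" "i - 1 \<in> {..d}" "i \<in> {..d}"
      using i by auto
    then have ne: "th (i - 1) \<noteq> th i" "ths (i - 1) \<noteq> ths i"
      using inj_onD[OF injt, of "i - 1" i] inj_onD[OF injs, of "i - 1" i] by blast+
    show "(th (i - 2) - th (i + 1)) / (th (i - 1) - th i) = p + 1 / p + 1"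
      by (rule three_term_quotient[OF p0 _ i ne(1)]) (rule th)
    show "(ths (i - 2) - ths (i + 1)) / (ths (i - 1) - ths i) = p + 1 / p + 1"
      by (rule three_term_quotient[OF p0 _ i ne(2)]) (rule ths0)
  qed
  have fc: "is_fundamental_constant scale d B As (q powi 2 + q powi (- 2))"
    unfolding is_fundamental_constant_def \<beta>
    using d quot parameter_arrayD(1-3)[OF pa] by blast
  have p1: "p \<noteq> 1"
    using bspec[OF root, of 1] d by simp
  have p2: "p ^ 2 \<noteq> 1"
    using bspec[OF root, of 2] d by simp
  have "p + 1 / p \<noteq> 2"
  proof
    assume "p + 1 / p = 2"
    then have "(p - 1) ^ 2 = 0"
      using p0 by (simp add: field_simps power2_eq_square)
    then show False
      using p1 by simp
  qed
  moreover have "p + 1 / p \<noteq> - 2"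
  proof
    assume "p + 1 / p = - 2"
    then have "p * p + 1 + 2 * p = 0"
      using p0 by (simp add: field_simps)
    then have "(p + 1) ^ 2 = 0"
      by (simp add: algebra_simps power2_eq_square)
    then have "p = - 1"
      by (simp add: eq_neg_iff_add_eq_0)
    then show False
      using p2 by simp
  qed
  ultimately have tI: "type_I scale d B As"
    using fc unfolding type_I_def \<beta> by blast
  have "(ths (i - 1) - ths i) / (ths i - ths (i + 1)) = 1 / p" if i: "i \<in> {1..d - 1}" for i
  proof -
    obtain k where k: "i = Suc k" "Suc k < d"
      using i d by (cases i) auto
    have "ths (i - 1) - ths i = ms * p ^ k * (1 - p)"
      "ths i - ths (i + 1) = ms * p ^ k * (1 - p) * p"
      using ths[of k] ths[of "Suc k"] ths[of "Suc (Suc k)"] k by (simp_all add: algebra_simps)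
    then show ?thesis
      using p0 p1 mn(2) by simp
  qed
  moreover have "vphi i / phi i = m / (n / p ^ d)" if i: "i \<in> {1..d}" for i
  proof -
    \<comment> \<open>The two split sequences differ only in the scalar \<open>m\<close> or
      \<open>n / p ^ d\<close> in front of \<open>X\<close>.\<close>
    define X where "X = kraw_factor d p 1 i"
    have kraw_factor: "kraw_factor d p c i = c * X" for c
      by (simp only: X_def kraw_factor_def mult_minus_left mult_minus_right mult_1_left mult.assoc)
    have "X \<noteq> 0"
      unfolding X_def by (rule kraw_factor_nonzero[OF root _ i]) simp
    moreover have "vphi i = ms * p ^ (i - 1) * (m * X)"
      using K i by (simp add: kraw_split_def kraw_factor)
    moreover have "phi i = ms * p ^ (i - 1) * (n / p ^ d * X)"
      using phi i by (simp add: kraw_factor)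
    ultimately show ?thesis
      using mn p0 by simp
  qed
  ultimately show ?thesis
    unfolding dual_q_krawtchouk_type_def using tI q fc pa by blast
qed

lemma contraction_of_dual_q_krawtchouk:
  assumes two: "(2::'a) \<noteq> 0" and d: "3 \<le> d"
    and dual: "dual_q_krawtchouk_type scale d q A As"
    and pa: "parameter_array scale d A As th ths vphi phi"
    and data: "primary_q_data d q th ths vphi phi \<delta> \<mu> h \<delta>s \<mu>s 0 \<tau>"
    and \<mu>': "\<mu>' + h' = 0" "\<mu>' * h' = \<mu> * h"
    and th': "\<forall>i\<le>d. th' i = \<mu>' * q powi (2 * int i - int d) + h' * q powi (int d - 2 * int i)"
    and split': "\<forall>i\<in>{1..d}.
      vphi' i = h' * \<mu>s * q powi (2 * int i - int d - 1) * split_factor d q i \<and>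
      phi' i = \<mu>' * \<mu>s * q powi (2 * int i - int d - 1) * split_factor d q i"
  shows "near_bipartite scale d A As \<longleftrightarrow> reinforced_dual_q_krawtchouk_type scale d q A As"
    and "near_bipartite scale d A As \<Longrightarrow>
      reinforced_dual_q_krawtchouk_type scale d q (contraction scale A As) As \<and>
      parameter_array scale d (contraction scale A As) As th' ths vphi' phi'"
proof -
  define p Q where "p = q ^ 2" and "Q = q ^ d"
  have q: "q \<noteq> 0"
    by (rule dual_q_krawtchouk_type_facts(3)[OF dual d pa])
  then have nz: "p \<noteq> 0" "Q \<noteq> 0" and Q2: "p ^ d = Q * Q"
    by (simp_all add: p_def Q_def power_mult[symmetric] power_add[symmetric] mult_2)
  note conv = powi_convert[OF q, where d = d, folded p_def Q_def]
    split_factor_convert[OF q, where d = d, folded p_def Q_def]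
  \<comment> \<open>With this scaling \<open>m * n = \<mu> * h\<close> and
    \<open>n + m * p ^ d = (\<mu> + h) * q ^ d\<close>.\<close>
  define m n ms where "m = \<mu> / Q" and "n = h * Q" and "ms = \<mu>s / Q"
  have injt: "inj_on th {..d}"
    using parameter_arrayD(2)[OF pa] by (rule standard_orderingE)
  have injs: "inj_on ths {..d}"
    using parameter_arrayD(3)[OF pa] by (rule standard_orderingE)
  have th: "th i = \<delta> + m * p ^ i + n / p ^ i" if "i \<le> d" for i
    using data that by (simp add: primary_q_data_def conv m_def n_def)
  have ths: "ths i = \<delta>s + ms * p ^ i" if "i \<le> d" for i
    using data that by (simp add: primary_q_data_def conv ms_def)
  have root: "\<forall>l\<in>{1..d}. p ^ l \<noteq> 1"
  proof (intro ballI notI)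
    fix l assume l: "l \<in> {1..d}" "p ^ l = 1"
    then have "th l = th 0"
      using th by simp
    then have "l = 0"
      using l(1) by (intro inj_onD[OF injt]) auto
    then show False
      using l(1) by simp
  qed
  have ms: "ms \<noteq> 0"
    using ths[of 0] ths[of 1] d inj_onD[OF injs, of 0 1] by auto
  define s where "s i = (p ^ i - 1) * (p ^ (d + 1 - i) - 1) / (Q * q)" for i
  have vphi: "vphi i = s i * (\<tau> - \<mu> * \<mu>s * (p ^ i / (Q * q)))"
    and phi: "phi i = s i * (\<tau> - h * \<mu>s * (p ^ i / (Q * q)))" if "i \<in> {1..d}" for i
    using data that by (simp_all add: primary_q_data_def conv s_def)
  have s_nz: "s 1 \<noteq> 0"
    using bspec[OF root, of 1] bspec[OF root, of d] d nz q by (simp add: s_def)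
  \<comment> \<open>In the end relation the \<open>\<mu>\<close> terms cancel, since they follow the
    progression of \<open>ths\<close>; what remains is \<open>\<tau> * (p ^ (d - 1) - 1)\<close>
    times nonzero factors.\<close>
  have "\<tau> = 0"
  proof -
    define X where "X = \<mu> * \<mu>s / (Q * q)"
    have "s d = s 1"
      using d by (simp add: s_def)
    then have v: "vphi 1 = s 1 * (\<tau> - X * p)" "vphi d = s 1 * (\<tau> - X * (p * p ^ (d - 1)))"
      using vphi[of 1] vphi[of d] d by (simp_all add: X_def flip: power_Suc)
    have t: "ths 0 - ths 1 = ms * (1 - p)" "ths (d - 1) - ths d = ms * (1 - p) * p ^ (d - 1)"
      using ths[of 0] ths[of 1] ths[of "d - 1"] ths[of d] d
      by (simp_all add: algebra_simps flip: power_Suc)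
    have "vphi 1 * (ths (d - 1) - ths d) - vphi d * (ths 0 - ths 1) = 0"
      using dual_q_krawtchouk_type_facts(2)[OF dual d pa] by simp
    moreover have "vphi 1 * (ths (d - 1) - ths d) - vphi d * (ths 0 - ths 1) =
        s 1 * (ms * (1 - p)) * (\<tau> * (p ^ (d - 1) - 1))"
      unfolding v t by (simp add: algebra_simps)
    moreover have "p ^ (d - 1) \<noteq> 1" "p \<noteq> 1"
      using bspec[OF root, of "d - 1"] bspec[OF root, of 1] d by auto
    ultimately show ?thesis
      using s_nz ms by auto
  qed
  \<comment> \<open>The exponent drops from \<open>i\<close> to \<open>i - 1\<close> because the two
    factors \<open>q\<close> in the denominators combine to \<open>p\<close>.\<close>
  have sk: "s i * (c * \<mu>s * (p ^ i / (Q * q))) = - (ms * p ^ (i - 1) * kraw_factor d p (c / Q) i)"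
    if "i \<in> {1..d}" for i c
  proof -
    obtain k where "i = Suc k"
      using \<open>i \<in> {1..d}\<close> by (cases i) auto
    then show ?thesis
      using nz q by (simp add: s_def kraw_factor_def ms_def p_def power2_eq_square)
  qed
  have n_rev: "n / p ^ d = h / Q"
    using nz by (simp add: n_def Q2)
  have K: "kraw_split d p \<delta> m n \<delta>s ms th ths vphi"
    unfolding kraw_split_def m_def
    using th[unfolded m_def] ths vphi sk[of _ \<mu>] \<open>\<tau> = 0\<close> by simp
  have phi_K: "\<forall>i\<in>{1..d}. phi i = ms * p ^ (i - 1) * kraw_factor d p (n / p ^ d) i"
    unfolding n_rev using phi sk[of _ h] \<open>\<tau> = 0\<close> by simp
  have "\<mu> \<noteq> 0" "h \<noteq> 0"
    using parameter_array_first_nonzero[OF pa] vphi[of 1] phi[of 1] d \<open>\<tau> = 0\<close> by auto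
  then have mn: "m * n \<noteq> 0"
    using nz by (simp add: m_def n_def)
  let ?m' = "\<mu>' / Q" and ?n' = "h' * Q"
  have n'1: "?n' + ?m' * p ^ d = 0"
    using \<mu>'(1) nz by (simp add: Q2 distrib_right[symmetric] add.commute)
  have n'2: "?m' * ?n' = m * n"
    using \<mu>'(2) nz by (simp add: m_def n_def)
  \<comment> \<open>This reconciles the signs: \<open>h'\<close> in \<open>vphi'\<close> is the
    \<open>- \<mu>'\<close> of the general formula, and \<open>\<mu>'\<close> in \<open>phi'\<close>
    is its \<open>- h'\<close>.\<close>
  have h': "h' = - \<mu>'" "\<mu>' = - h'"
    using \<mu>'(1) by (simp_all add: eq_neg_iff_add_eq_0 add.commute)
  have split_eq: "c * \<mu>s * q powi (2 * int i - int d - 1) * split_factor d q i =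
      ms * p ^ (i - 1) * kraw_factor d p (- c / Q) i" if "i \<in> {1..d}" for i c
  proof -
    have "c * \<mu>s * q powi (2 * int i - int d - 1) * split_factor d q i =
        - (s i * (- c * \<mu>s * (p ^ i / (Q * q))))"
      using that by (simp add: conv s_def)
    then show ?thesis
      unfolding sk[OF that] by simp
  qed
  have K': "kraw_split d p 0 ?m' ?n' \<delta>s ms th' ths vphi'"
    unfolding kraw_split_def using th' split' ths split_eq[of _ h'] h'(2)
    by (simp add: conv)
  have phi_K': "\<forall>i\<in>{1..d}. phi' i = ms * p ^ (i - 1) * kraw_factor d p (?n' / p ^ d) i"
  proof
    fix i assume i: "i \<in> {1..d}"
    have "?n' / p ^ d = - \<mu>' / Q"
      using nz by (simp add: Q2 h'(1))
    then show "phi' i = ms * p ^ (i - 1) * kraw_factor d p (?n' / p ^ d) i"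
      using split' split_eq[OF i, of \<mu>'] i by simp
  qed
  obtain v where v: "split_basis d A As th ths vphi v"
    using parameter_arrayD(4)[OF pa] by blast
  note main = krawtchouk_contraction[OF two parameter_arrayD(1)[OF pa] parameter_arrayD(3)[OF pa] v
      nz(1) root K mn ms n'1 n'2 K' phi_K']
  have re: "(\<forall>k\<in>{1..d - 1}. p ^ k \<noteq> - 1) \<longleftrightarrow> (\<forall>i\<in>{1..d - 1}. q ^ (2 * i) \<noteq> - 1)"
    by (simp add: p_def power_mult)
  show "near_bipartite scale d A As \<longleftrightarrow> reinforced_dual_q_krawtchouk_type scale d q A As"
    unfolding reinforced_dual_q_krawtchouk_type_def main(1) re using dual by blast
  assume nb: "near_bipartite scale d A As"
  note pa' = main(2)[OF nb]
  have mn': "?m' * ?n' \<noteq> 0"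
    unfolding n'2 by (rule mn)
  have "dual_q_krawtchouk_type scale d q (contraction scale A As) As"
    by (rule dual_q_krawtchouk_typeI[OF pa' d q p_def root K' mn' ms phi_K'])
  then show "reinforced_dual_q_krawtchouk_type scale d q (contraction scale A As) As \<and>
      parameter_array scale d (contraction scale A As) As th' ths vphi' phi'"
    unfolding reinforced_dual_q_krawtchouk_type_def using pa' nb main(1) re by blast
qed

end

theorem corollary23p9:
  fixes scale :: "'f::alg_closed_field \<Rightarrow> 'v::ab_group_add \<Rightarrow> 'v"
    and d :: nat and q :: 'f
    and A As :: "'v \<Rightarrow> 'v"
    and th ths vphi phi th' vphi' phi' :: "nat \<Rightarrow> 'f"
    and \<delta> \<mu> h \<delta>s \<mu>s hs \<tau> \<mu>' h' :: 'f
  assumes "vector_space scale"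
    and "CHAR('f) \<noteq> 2"
    and "3 \<le> d"
    and "leonard_pair scale d A As"
    and "dual_q_krawtchouk_type scale d q A As"
    and "parameter_array scale d A As th ths vphi phi"
    and "primary_q_data d q th ths vphi phi \<delta> \<mu> h \<delta>s \<mu>s hs \<tau>"
    and "\<mu>' + h' = 0" and "\<mu>' * h' = \<mu> * h"
    and "\<forall>i\<le>d. th' i = \<mu>' * q powi (2 * int i - int d) + h' * q powi (int d - 2 * int i)"
    and "\<mu>s = 0 \<Longrightarrow> \<forall>i\<in>{1..d}.
           vphi' i = \<mu>' * hs * q powi (int d - 2 * int i + 1) * split_factor d q i \<and>
           phi' i = h' * hs * q powi (int d - 2 * int i + 1) * split_factor d q i"
    and "hs = 0 \<Longrightarrow> \<forall>i\<in>{1..d}.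
           vphi' i = h' * \<mu>s * q powi (2 * int i - int d - 1) * split_factor d q i \<and>
           phi' i = \<mu>' * \<mu>s * q powi (2 * int i - int d - 1) * split_factor d q i"
  shows "(near_bipartite scale d A As \<longleftrightarrow>
            reinforced_dual_q_krawtchouk_type scale d q A As) \<and>
         (near_bipartite scale d A As \<longrightarrow>
            reinforced_dual_q_krawtchouk_type scale d q
              (contraction scale A As) As \<and>
            parameter_array scale d
              (contraction scale A As) As th' ths vphi' phi')"
proof -
  interpret coordinate_space scale
    using assms(1) by (simp add: coordinate_space_def)
  note d = assms(3) and dual = assms(5) and pa = assms(6) and data = assms(7)
  have two: "(2::'f) \<noteq> 0"
  proof
    assume "(2::'f) = 0"
    then have "of_nat 2 = (0::'f)"
      by simp
    then have "CHAR('f) dvd 2"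
      by (simp only: of_nat_eq_0_iff_char_dvd)
    then have "CHAR('f) = 1"
      using assms(2) two_is_prime_nat prime_nat_iff by blast
    then show False
      using of_nat_CHAR[where ?'a = 'f] by simp
  qed
  have q: "q \<noteq> 0"
    by (rule dual_q_krawtchouk_type_facts(3)[OF dual d pa])
  have injt: "inj_on th {..d}"
    using parameter_arrayD(2)[OF pa] by (rule standard_orderingE)
  \<comment> \<open>Needed already for the original \<open>q\<close>, to decide which of
    \<open>\<mu>s\<close> and \<open>hs\<close> vanishes before choosing between \<open>q\<close>
    and \<open>inverse q\<close>.\<close>
  have root: "(q ^ 2) ^ l \<noteq> 1" if "l \<in> {1..d}" for l
  proof
    assume "(q ^ 2) ^ l = 1"
    then have "th l = th 0"
      using data that by (simp add: primary_q_data_def powi_convert[OF q])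
    then have "l = 0"
      using that by (intro inj_onD[OF injt]) auto
    then show False
      using that by simp
  qed
  have "\<mu>s / q ^ d * (hs * q ^ d) = 0"
  proof (rule geometric_pair_product)
    show "q ^ 2 \<noteq> 0" "q ^ 2 \<noteq> 1" "(q ^ 2) ^ 2 \<noteq> 1"
      using q root[of 1] root[of 2] d by auto
    show "(ths 0 - ths 1) * (ths 2 - ths 3) = (ths 1 - ths 2)\<^sup>2"
      by (rule dual_q_krawtchouk_type_facts(1)[OF dual d pa])
    show "ths i = \<delta>s + \<mu>s / q ^ d * (q ^ 2) ^ i + hs * q ^ d / (q ^ 2) ^ i" if "i \<le> 3" for i
      using data that d by (simp add: primary_q_data_def powi_convert[OF q])
  qed
  then consider "hs = 0" | "\<mu>s = 0"
    using q by auto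
  then show ?thesis
  proof cases
    case 1
    note half = contraction_of_dual_q_krawtchouk[OF two d dual pa data[unfolded 1]
        assms(8,9,10) assms(12)[OF 1]]
    show ?thesis
      using half by blast
  next
    case 2
    have dual': "dual_q_krawtchouk_type scale d (inverse q) A As"
      using dual by (simp only: dual_q_krawtchouk_type_inverse)
    \<comment> \<open>Inverting \<open>q\<close> exchanges \<open>\<mu>\<close> with
      \<open>h\<close>; exchanging \<open>\<mu>'\<close> with \<open>h'\<close> as well leaves
      \<open>th'\<close> unchanged.\<close>
    have sum: "h' + \<mu>' = 0" and prod: "h' * \<mu>' = h * \<mu>"
      using assms(8,9) by (simp_all add: ac_simps)
    have th'': "\<forall>i\<le>d. th' i = h' * inverse q powi (2 * int i - int d) +
        \<mu>' * inverse q powi (int d - 2 * int i)"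
      using assms(10) by (simp add: inverse_powi add.commute)
    have split'': "\<forall>i\<in>{1..d}.
        vphi' i = \<mu>' * hs * inverse q powi (2 * int i - int d - 1) * split_factor d (inverse q) i \<and>
        phi' i = h' * hs * inverse q powi (2 * int i - int d - 1) * split_factor d (inverse q) i"
      using assms(11)[OF 2] by (simp add: inverse_powi split_factor_inverse algebra_simps)
    note half = contraction_of_dual_q_krawtchouk[OF two d dual' pa
        primary_q_data_inverse[OF data, unfolded 2] sum prod th'' split'']
    show ?thesis
      using half unfolding reinforced_dual_q_krawtchouk_type_inverse by blast
  qed
qed

end
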